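(* (i) There is an online algorithm for the single-item Byzantine secretary problem whose selected item has expected value at least $\Omega(1/\log^* n)\cdot \mathrm{OPT}(\mathcal{G}\setminus g_{\max})$. (ii) There is an online algorithm for the matroid Byzantine secretary problem on a matroid of rank $r$ whose selected independent set has expected total value at least $\Omega\big(1/((\log^* n)^2\log r)\big)\cdot \mathrm{OPT}(\mathcal{G}\setminus g_{\max})$.
   Context: Byzantine secretary model: there are $n$ items with nonnegative values $\mathrm{val}(e)$, partitioned (unknown to the algorithm) into green items $\mathcal{G}$ and red items. An adversary chooses all values and the arrival times in $[0,1]$ of the red items; each green item independently chooses a uniformly random arrival time in $[0,1]$. Items are revealed in order of arrival, and decisions to select an item are made irrevocably upon arrival. $g_{\max}$ is the green item of largest value. In the single-item problem the algorithm (which knows $n$) may select at most one item, and $\mathrm{OPT}(\mathcal{G}\setminus g_{\max})$ is the value of the second most valuable green item. In the matroid problem the items form the ground set of a matroid of rank $r$; the algorithm knows $r$ and $n$ but learns the matroid structure (independence among arrived items) only as items arrive, and the selected set must be independent; $\mathrm{OPT}(\mathcal{G}\setminus g_{\max})$ is the maximum total value of an independent set of green items not containing $g_{\max}$. Expectations are over the green arrival times and the algorithm's randomness, for every adversary; $\log^*$ is the iterated logarithm.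
   Formalization: In (ii), g_max is taken as the most valuable green item that is not a matroid loop (if g_max could be a loop the claim would be false), and log r is read as max(1, log_2 r), since for r = 1 the stated bound is undefined. *)

theory Defs
  imports "HOL-Probability.Probability"
begin

text \<open>The iterated binary logarithm. All iterates before the least \<open>k\<close> exceed \<open>1\<close>, so the value of
  \<^const>\<open>log\<close> at nonpositive arguments is never used.\<close>

definition log_star :: "real \<Rightarrow> nat" where
  "log_star x = (LEAST k. (log 2 ^^ k) x \<le> 1)"

definition matroid :: "'a set \<Rightarrow> ('a set \<Rightarrow> bool) \<Rightarrow> bool" where
  "matroid E indep \<longleftrightarrow>
     finite E \<and> indep {} \<and>
     (\<forall>X. indep X \<longrightarrow> X \<subseteq> E) \<and>
     (\<forall>X Y. indep X \<longrightarrow> Y \<subseteq> X \<longrightarrow> indep Y) \<and>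
     (\<forall>X Y. indep X \<longrightarrow> indep Y \<longrightarrow> card X < card Y \<longrightarrow> (\<exists>y\<in>Y - X. indep (insert y X)))"

definition matroid_rank :: "('a set \<Rightarrow> bool) \<Rightarrow> nat" where
  "matroid_rank indep = Max (card ` {X. indep X})"

text \<open>The items are \<open>{..<n}\<close>, \<open>G\<close> is the set of green items, and \<open>s\<close> gives the arrival times of the
  red items (its values on \<open>G\<close> are irrelevant). The labels are chosen by the adversary and are
  never shown to the algorithm; their only role is to order simultaneous arrivals.\<close>

definition byzantine_instance :: "nat \<Rightarrow> nat set \<Rightarrow> (nat \<Rightarrow> real) \<Rightarrow> (nat \<Rightarrow> real) \<Rightarrow> bool" where
  "byzantine_instance n G val s \<longleftrightarrow>
     G \<subseteq> {..<n} \<and> (\<forall>e<n. 0 \<le> val e) \<and> (\<forall>e\<in>{..<n} - G. s e \<in> {0..1})"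

definition arrival_time :: "nat set \<Rightarrow> (nat \<Rightarrow> real) \<Rightarrow> (nat \<Rightarrow> real) \<Rightarrow> nat \<Rightarrow> real" where
  "arrival_time G s u e = (if e \<in> G then u e else s e)"

definition arrival_order :: "nat \<Rightarrow> (nat \<Rightarrow> real) \<Rightarrow> nat list" where
  "arrival_order n t = sort_key t [0..<n]"

text \<open>The algorithm's internal randomness is a real seed \<open>\<omega>\<close>, of an arbitrary Borel distribution,
  independent of the arrival times \<open>u\<close> of the green items.\<close>

definition seed_distribution :: "real measure \<Rightarrow> bool" where
  "seed_distribution R \<longleftrightarrow> prob_space R \<and> sets R = sets borel"

definition outcomes :: "real measure \<Rightarrow> nat set \<Rightarrow> (real \<times> (nat \<Rightarrow> real)) measure" where
  "outcomes R G = R \<Otimes>\<^sub>M (\<Pi>\<^sub>M e\<in>G. uniform_measure lborel {0..1})"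

text \<open>Observed prefix of the arrivals: pairs of arrival time and value, in order of arrival.\<close>

type_synonym history = "(real \<times> real) list"

definition history :: "(nat \<Rightarrow> real) \<Rightarrow> (nat \<Rightarrow> real) \<Rightarrow> nat list \<Rightarrow> history" where
  "history val t es = map (\<lambda>e. (t e, val e)) es"

text \<open>The independent sets among the arrived items, each item being named by its position in the
  order of arrival.\<close>

definition revealed_indep :: "(nat set \<Rightarrow> bool) \<Rightarrow> nat list \<Rightarrow> nat set set" where
  "revealed_indep indep es = {K. K \<subseteq> {..<length es} \<and> indep ((!) es ` K)}"

text \<open>An online algorithm maps the seed and everything observed up to and including the current
  arrival to the decision whether to select the current item. Earlier decisions are functions of
  the same data, so they need not be arguments.\<close>

type_synonym single_algorithm = "real \<Rightarrow> history \<Rightarrow> bool"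
type_synonym matroid_algorithm = "real \<Rightarrow> history \<Rightarrow> nat set set \<Rightarrow> bool"

definition online_selection :: "nat list \<Rightarrow> (nat list \<Rightarrow> bool) \<Rightarrow> nat set" where
  "online_selection es D = {es ! k |k. k < length es \<and> D (take (Suc k) es)}"

definition single_selected ::
  "single_algorithm \<Rightarrow> nat \<Rightarrow> (nat \<Rightarrow> real) \<Rightarrow> (nat \<Rightarrow> real) \<Rightarrow> real \<Rightarrow> nat set" where
  "single_selected A n val t \<omega> =
     online_selection (arrival_order n t) (\<lambda>es. A \<omega> (history val t es))"

definition matroid_selected ::
  "matroid_algorithm \<Rightarrow> nat \<Rightarrow> (nat set \<Rightarrow> bool) \<Rightarrow> (nat \<Rightarrow> real) \<Rightarrow> (nat \<Rightarrow> real) \<Rightarrow> real \<Rightarrow> nat set" where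
  "matroid_selected A n indep val t \<omega> =
     online_selection (arrival_order n t) (\<lambda>es. A \<omega> (history val t es) (revealed_indep indep es))"

definition single_payoff ::
  "single_algorithm \<Rightarrow> nat \<Rightarrow> nat set \<Rightarrow> (nat \<Rightarrow> real) \<Rightarrow> (nat \<Rightarrow> real) \<Rightarrow> real \<times> (nat \<Rightarrow> real) \<Rightarrow> real" where
  "single_payoff A n G val s = (\<lambda>(\<omega>, u). sum val (single_selected A n val (arrival_time G s u) \<omega>))"

definition matroid_payoff ::
  "matroid_algorithm \<Rightarrow> nat \<Rightarrow> (nat set \<Rightarrow> bool) \<Rightarrow> nat set \<Rightarrow> (nat \<Rightarrow> real) \<Rightarrow> (nat \<Rightarrow> real) \<Rightarrow>
   real \<times> (nat \<Rightarrow> real) \<Rightarrow> real" where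
  "matroid_payoff A n indep G val s =
     (\<lambda>(\<omega>, u). sum val (matroid_selected A n indep val (arrival_time G s u) \<omega>))"

text \<open>The value of the best item of \<open>S\<close>, and \<open>0\<close> if \<open>S\<close> is empty.\<close>

definition single_opt :: "(nat \<Rightarrow> real) \<Rightarrow> nat set \<Rightarrow> real" where
  "single_opt val S = Max (insert 0 (val ` S))"

definition matroid_opt :: "(nat set \<Rightarrow> bool) \<Rightarrow> (nat \<Rightarrow> real) \<Rightarrow> nat set \<Rightarrow> real" where
  "matroid_opt indep val S = Max (sum val ` {I. indep I \<and> I \<subseteq> S})"

definition most_valuable :: "(nat \<Rightarrow> real) \<Rightarrow> nat set \<Rightarrow> nat \<Rightarrow> bool" where
  "most_valuable val S g \<longleftrightarrow> g \<in> S \<and> (\<forall>h\<in>S. val h \<le> val g)"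

text \<open>In the matroid problem a loop can never be selected, and removing a green loop from the
  benchmark has no effect. With a loop as most valuable green item, the benchmark would be the
  full green optimum, which no algorithm can approximate. Hence the removed item is the most
  valuable item among the green non-loops.\<close>

definition non_loops :: "(nat set \<Rightarrow> bool) \<Rightarrow> nat set \<Rightarrow> nat set" where
  "non_loops indep S = {e \<in> S. indep {e}}"

end

theory Submission
  imports Defs
begin

text \<open>Split time into windows \<open>W\<^sub>0, \<dots>, W\<^bsub>m+1\<^esub>\<close> with \<open>m = log* n\<close>, the last two of
  constant length. Let \<open>V\<close> be the benchmark, \<open>g\<close> the removed item, and \<open>h\<close> an item of an optimal
  set with \<open>V \<le> r val h\<close>. For a random \<open>k\<close> the algorithm takes the best non-loop value seen in
  \<open>W\<^sub>k\<close> as an estimate of \<open>V\<close>, scales it by a random power of two, and selects greedily in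
  \<open>W\<^bsub>k+1\<^esub>\<close> among the items above the resulting threshold. Large red items never hurt
  during selection; they only spoil estimates.

  When \<open>h\<close> arrives in \<open>W\<^sub>k\<close> and \<open>g\<close> in the last window, the estimate is correct up to
  a factor \<open>r T\<^sub>k\<close>, where \<open>T\<^sub>k V\<close> bounds the red items of \<open>W\<^sub>k\<close>, so that
  \<open>O(log (r T\<^sub>k))\<close> scales suffice. The red items have fixed arrival times. Hence a red item in
  \<open>W\<^bsub>k+1\<^esub>\<close> that is more valuable than \<open>V\<close> by a factor much larger than the number of scales
  already makes the expected payoff large enough, and otherwise \<open>T\<^bsub>k+1\<^esub>\<close> is about \<open>log T\<^sub>k\<close>.
  The start \<open>T\<^sub>0 = n\<close> comes from selecting an item at a random position. After \<open>m\<close>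
  refinements only \<open>O(m + log r)\<close> scales are left, and the random-threshold argument on the last
  window gives the competitive ratio \<open>O(m log r)\<close>, for both parts of the theorem.\<close>

subsection \<open>The iterated logarithm\<close>

text \<open>The \<open>LEAST\<close> in \<open>log_star\<close> is attained: an x between 1 and N +
  2 is at most 2 ^ (N + 1), so each logarithm lowers the integer bound by one.\<close>

lemma log_iterate_le_one: "\<exists>k. (log 2 ^^ k) x \<le> 1"
proof -
  have "x \<le> real N + 1 \<Longrightarrow> \<exists>k. (log 2 ^^ k) x \<le> 1" for N
  proof (induction N arbitrary: x)
    case 0
    then have "(log 2 ^^ 0) x \<le> 1"
      by simp
    then show ?case ..
  next
    case (Suc N)
    show ?case
    proof (cases "x \<le> 1")
      case True
      then have "(log 2 ^^ 0) x \<le> 1"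
        by simp
      then show ?thesis ..
    next
      case False
      have "Suc N < 2 ^ Suc N"
        by (rule less_exp)
      then have "real (Suc N) + 1 \<le> 2 ^ Suc N"
        by (metis Suc_leI of_nat_Suc of_nat_le_iff of_nat_numeral of_nat_power add.commute)
      with Suc.prems have "x \<le> 2 ^ Suc N"
        by simp
      then have "x \<le> 2 powr real (Suc N)"
        by (subst powr_realpow) auto
      then have "log 2 x \<le> real N + 1"
        using False by (subst log_le_iff) (auto simp: add.commute)
      then obtain k where "(log 2 ^^ k) (log 2 x) \<le> 1"
        using Suc.IH by blast
      then have "(log 2 ^^ Suc k) x \<le> 1"
        by (simp add: funpow_swap1)
      then show ?thesis ..
    qed
  qed
  moreover have "x \<le> real (nat \<lceil>x\<rceil>) + 1"
    by linarith
  ultimately show ?thesis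
    by blast
qed

definition level :: "nat \<Rightarrow> nat \<Rightarrow> real" where
  "level n k = max 1 ((log 2 ^^ k) (real n))"

lemma level_ge_one: "1 \<le> level n k"
  by (simp add: level_def)

text \<open>Lets the number of scales at stage k be paid for by the level of stage k + 1. Where the
  truncation at 1 is active, the left side is 0.\<close>

lemma log_level_le: "log 2 (level n k) \<le> level n (Suc k)"
  by (simp add: level_def max_def)

lemma log2_less_self: "0 < x \<Longrightarrow> log 2 x < x"
proof -
  assume x: "0 < x"
  have "x < 2 powr x"
  proof -
    have "real (nat \<lfloor>x\<rfloor>) + 1 \<le> 2 ^ nat \<lfloor>x\<rfloor>"
      using Suc_leI[OF less_exp[of "nat \<lfloor>x\<rfloor>"]] 
      by (metis of_nat_Suc of_nat_le_iff of_nat_numeral of_nat_power add.commute)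
    also have "\<dots> = 2 powr real (nat \<lfloor>x\<rfloor>)"
      by (simp add: powr_realpow)
    also have "\<dots> \<le> 2 powr x"
      using x by (intro powr_mono) auto
    finally show ?thesis
      using x by linarith
  qed
  then show ?thesis
    using x by (simp add: log_less_iff)
qed

text \<open>By minimality of \<open>log_star\<close> the k-th iterate still exceeds 1, so a
  logarithm really lowers it.\<close>

lemma level_Suc_le:
  assumes "k < log_star (real n)"
  shows "level n (Suc k) \<le> level n k"
proof -
  have "1 < (log 2 ^^ k) (real n)"
    using not_less_Least[OF assms[unfolded log_star_def]] by simp
  then show ?thesis
    using log2_less_self[of "(log 2 ^^ k) (real n)"] by (auto simp: level_def max_def)
qed

lemma level_log_star: "level n (log_star (real n)) = 1"
proof -
  have "(log 2 ^^ log_star (real n)) (real n) \<le> 1"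
    unfolding log_star_def using log_iterate_le_one by (rule LeastI_ex)
  then show ?thesis
    by (simp add: level_def)
qed

lemma log_star_pos:
  assumes "2 \<le> n"
  shows "0 < log_star (real n)"
proof (rule ccontr)
  assume "\<not> 0 < log_star (real n)"
  then have "log_star (real n) = 0" by simp
  then have "level n 0 = 1"
    using level_log_star[of n] by simp
  then show False
    using assms by (simp add: level_def)
qed

lemma log_star_le_one: "n \<le> 1 \<Longrightarrow> log_star (real n) = 0"
  by (simp add: log_star_def)

subsection \<open>Greedy online selection\<close>

primrec greedy :: "nat set set \<Rightarrow> (nat \<Rightarrow> bool) \<Rightarrow> nat \<Rightarrow> nat set" where
  "greedy F C 0 = {}"
| "greedy F C (Suc i) =
     (if C i \<and> insert i (greedy F C i) \<in> F then insert i (greedy F C i) else greedy F C i)"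

lemma greedy_subset: "greedy F C i \<subseteq> {..<i} \<inter> Collect C"
  by (induction i) (auto simp: less_Suc_eq)

lemma greedy_mem: "{} \<in> F \<Longrightarrow> greedy F C i \<in> F"
  by (induction i) auto

lemma greedy_mono: "i \<le> j \<Longrightarrow> greedy F C i \<subseteq> greedy F C j"
  by (induction rule: dec_induct) auto

lemma greedy_restrict:
  assumes "i < j"
  shows "i \<in> greedy F C j \<longleftrightarrow> i \<in> greedy F C (Suc i)"
  using Suc_leI[OF assms]
proof (induction rule: dec_induct)
  case (step l)
  then show ?case
    by auto
qed simp

text \<open>The first i steps look only at positions below i. Hence a run recomputed on a prefix
  agrees with the run on the full sequence.\<close>

lemma greedy_cong:
  assumes "\<And>l. l < i \<Longrightarrow> C l = C' l"
    and "\<And>K. K \<subseteq> {..<i} \<Longrightarrow> K \<in> F \<longleftrightarrow> K \<in> F'"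
  shows "greedy F C i = greedy F' C' i"
  using assms
proof (induction i)
  case (Suc i)
  have "K \<subseteq> {..<i} \<Longrightarrow> K \<in> F \<longleftrightarrow> K \<in> F'" for K
    using Suc.prems(2)[of K] by (meson less_SucI lessThan_iff subset_eq)
  then have eq: "greedy F C i = greedy F' C' i"
    using Suc by simp
  moreover have "insert i (greedy F' C' i) \<subseteq> {..<Suc i}"
    using greedy_subset[of F' C' i] by (auto simp: subset_eq)
  ultimately show ?case
    using Suc.prems by auto
qed simp

lemma revealed_indep_take:
  assumes "l \<le> length es" "K \<subseteq> {..<l}"
  shows "K \<in> revealed_indep indep (take l es) \<longleftrightarrow> K \<in> revealed_indep indep es"
proof -
  have "(!) (take l es) ` K = (!) es ` K"
    using assms by (intro image_cong) auto
  then show ?thesis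
    using assms by (auto simp: revealed_indep_def)
qed

text \<open>The algorithm stores no state: at each arrival it reruns greedy on the prefix, with a
  candidate test \<open>C l\<close> that may change with the prefix. As long as these tests agree
  with one fixed set K, all runs are initial segments of a single run. Its result is maximal in K,
  since an item rejected as dependent stays dependent when the selection grows.\<close>

lemma online_selection_greedy:
  assumes hered: "\<And>X Y. indep X \<Longrightarrow> Y \<subseteq> X \<Longrightarrow> indep Y" and "indep {}"
    and D: "\<And>l. l < length es \<Longrightarrow>
      D (take (Suc l) es) \<longleftrightarrow> l \<in> greedy (revealed_indep indep (take (Suc l) es)) (C l) (Suc l)"
    and C: "\<And>l i. l < length es \<Longrightarrow> i \<le> l \<Longrightarrow> C l i \<longleftrightarrow> es ! i \<in> K"
  shows "indep (online_selection es D)"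
    and "online_selection es D \<subseteq> K"
    and "e \<in> K \<Longrightarrow> e \<in> set es \<Longrightarrow> e \<notin> online_selection es D \<Longrightarrow>
      \<not> indep (insert e (online_selection es D))"
proof -
  let ?F = "revealed_indep indep es" and ?C = "\<lambda>i. es ! i \<in> K"
  define \<gamma> where "\<gamma> = greedy ?F ?C"
  have D': "D (take (Suc l) es) \<longleftrightarrow> l \<in> \<gamma> (length es)" if l: "l < length es" for l
  proof -
    have "greedy (revealed_indep indep (take (Suc l) es)) (C l) (Suc l) = \<gamma> (Suc l)"
      unfolding \<gamma>_def
      by (rule greedy_cong) (use l C revealed_indep_take[of "Suc l" es] in auto)
    then show ?thesis
      using D[OF l] greedy_restrict[OF l] by (simp add: \<gamma>_def)
  qed
  have sub: "\<gamma> i \<subseteq> {..<i} \<inter> Collect ?C" for i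
    unfolding \<gamma>_def by (rule greedy_subset)
  have eq: "online_selection es D = (!) es ` \<gamma> (length es)"
    using D' sub[of "length es"] by (auto simp: online_selection_def)
  have "\<gamma> (length es) \<in> ?F"
    unfolding \<gamma>_def by (rule greedy_mem) (simp add: revealed_indep_def \<open>indep {}\<close>)
  then show "indep (online_selection es D)"
    by (simp add: eq revealed_indep_def)
  show "online_selection es D \<subseteq> K"
    using sub[of "length es"] by (auto simp: eq)
  show "\<not> indep (insert e (online_selection es D))"
    if e: "e \<in> K" "e \<in> set es" "e \<notin> online_selection es D"
  proof
    assume indep: "indep (insert e (online_selection es D))"
    obtain l where l: "l < length es" "e = es ! l"
      using e(2) by (auto simp: in_set_conv_nth)
    have "l \<notin> \<gamma> (length es)"
      using e l by (auto simp: eq)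
    then have "l \<notin> \<gamma> (Suc l)"
      using greedy_restrict[OF l(1)] by (simp add: \<gamma>_def)
    then have "insert l (\<gamma> l) \<notin> ?F"
      using e l by (auto simp: \<gamma>_def split: if_splits)
    moreover have "insert l (\<gamma> l) \<subseteq> {..<length es}"
      using sub[of l] l by auto
    ultimately have "\<not> indep ((!) es ` insert l (\<gamma> l))"
      by (auto simp: revealed_indep_def)
    moreover have "(!) es ` insert l (\<gamma> l) \<subseteq> insert e (online_selection es D)"
      using greedy_mono[of l "length es" ?F ?C] l by (auto simp: eq \<gamma>_def)
    ultimately show False
      using hered indep by blast
  qed
qed

subsection \<open>The algorithm\<close>

text \<open>\<open>W\<^sub>m = [1/2, 3/4)\<close>, \<open>W\<^bsub>m+1\<^esub>\<close> starts at \<open>3/4\<close>, and the other windows divide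
  \<open>[0, 1/2)\<close> evenly. All reals are covered, so null events need no special treatment.\<close>

definition window :: "nat \<Rightarrow> real \<Rightarrow> nat" where
  "window m t = (if t < 1/2 then min (m - 1) (nat \<lfloor>2 * real m * t\<rfloor>) else if t < 3/4 then m else Suc m)"

lemma window_mono:
  assumes "x \<le> y"
  shows "window m x \<le> window m y"
proof -
  have "nat \<lfloor>2 * real m * x\<rfloor> \<le> nat \<lfloor>2 * real m * y\<rfloor>"
    using assms by (intro nat_mono floor_mono mult_left_mono) auto
  then show ?thesis
    using assms by (auto simp: window_def min_def)
qed

lemma window_measurable [measurable]: "window m \<in> borel \<rightarrow>\<^sub>M count_space UNIV"
  unfolding window_def by measurable

text \<open>The entries of \<open>ws\<close> are pairs of window and value. The condition
  \<open>{p} \<in> F\<close> excludes loops, and a window without non-loops gives 0.\<close>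

definition estimate :: "nat \<Rightarrow> (nat \<times> real) list \<Rightarrow> nat set set \<Rightarrow> real" where
  "estimate k ws F = Max (insert 0 {snd (ws ! p) |p. p < length ws \<and> fst (ws ! p) = k \<and> {p} \<in> F})"

text \<open>Stage \<open>0\<close> admits only the item at position \<open>j\<close>. Stage \<open>k' + 1\<close> selects in window \<open>k' + 1\<close>
  with the estimate from window \<open>k'\<close>, scaled by \<open>2\<^bsup>j - J k'\<^esup>\<close>.\<close>

definition candidate ::
  "(nat \<Rightarrow> nat) \<Rightarrow> nat \<Rightarrow> nat \<Rightarrow> (nat \<times> real) list \<Rightarrow> nat set set \<Rightarrow> nat \<Rightarrow> bool" where
  "candidate J k j ws F i \<longleftrightarrow> (case k of
       0 \<Rightarrow> i = j
     | Suc k' \<Rightarrow> fst (ws ! i) = k \<and> estimate k' ws F * 2 ^ j \<le> snd (ws ! i) * 2 ^ J k')"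

text \<open>The factor \<open>T\<^sub>k\<close>. Its part \<open>4\<^bsup>m\<^esup>\<close> absorbs the polynomial losses in \<open>m\<close>
  of a refinement step and adds only \<open>O(m)\<close> scales.\<close>

definition ratio_bound :: "nat \<Rightarrow> nat \<Rightarrow> real" where
  "ratio_bound n k = 4 ^ log_star (real n) * level n k"

text \<open>With J the value of this function, the scales 0 to 2 J move the estimate by factors from
  2 ^ (-J) to 2 ^ J, enough to correct an error of order \<open>r * ratio_bound n k\<close> in
  either direction.\<close>

definition num_scales :: "nat \<Rightarrow> nat \<Rightarrow> nat \<Rightarrow> nat" where
  "num_scales n r k = nat \<lceil>log 2 (4 * real r * ratio_bound n k)\<rceil>"

text \<open>The integer part of the seed codes the pair of stage and scale. The current item is the
  last of the history, at position \<open>length h - 1\<close>.\<close>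

definition byzantine_algorithm :: "nat \<Rightarrow> nat \<Rightarrow> matroid_algorithm" where
  "byzantine_algorithm n r \<omega> h F =
     (case prod_decode (nat \<lfloor>\<omega>\<rfloor>) of (k, j) \<Rightarrow>
        length h - 1 \<in> greedy F
          (candidate (num_scales n r) k j (map (\<lambda>(t, v). (window (log_star (real n)) t, v)) h) F) (length h))"

subsection \<open>Items selected in a fixed arrival order\<close>

lemma arrival_order_props:
  "length (arrival_order n t) = n" "set (arrival_order n t) = {..<n}"
  "distinct (arrival_order n t)" "sorted (map t (arrival_order n t))"
  by (auto simp: arrival_order_def)

text \<open>Exchange axiom: an independent Y larger than S would contain an element extending S. It
  compares the greedy selection with any independent set of candidates.\<close>

lemma matroid_card_le:
  assumes "matroid E indep" "indep S" "indep Y"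
    and max: "\<And>y. y \<in> Y \<Longrightarrow> y \<notin> S \<Longrightarrow> \<not> indep (insert y S)"
  shows "card Y \<le> card S"
proof (rule ccontr)
  assume "\<not> card Y \<le> card S"
  then have "card S < card Y" by simp
  then obtain y where "y \<in> Y - S" "indep (insert y S)"
    using assms(1-3) unfolding matroid_def by blast
  then show False
    using max by blast
qed

section \<open>A fixed instance, with selections described by items instead of positions\<close>

locale byzantine_matroid =
  fixes n r :: nat and indep :: "nat set \<Rightarrow> bool" and G :: "nat set" and val s :: "nat \<Rightarrow> real"
  assumes matroid: "matroid {..<n} indep"
    and rank: "matroid_rank indep = r"
    and inst: "byzantine_instance n G val s"
begin

abbreviation m :: nat where
  "m \<equiv> log_star (real n)"

lemma indep_empty: "indep {}"
  and indep_sub: "indep X \<Longrightarrow> X \<subseteq> {..<n}"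
  and indep_hered: "indep X \<Longrightarrow> Y \<subseteq> X \<Longrightarrow> indep Y"
  using matroid unfolding matroid_def by blast+

lemma indep_finite: "indep X \<Longrightarrow> finite X"
  using indep_sub finite_subset by blast

lemma finite_indep: "finite {X. indep X}"
  by (rule finite_subset[of _ "Pow {..<n}"]) (auto dest: indep_sub)

lemma card_indep_le: "indep X \<Longrightarrow> card X \<le> r"
  using rank finite_indep unfolding matroid_rank_def by (auto intro!: Max_ge)

lemma G_sub: "G \<subseteq> {..<n}"
  and val_nonneg: "e < n \<Longrightarrow> 0 \<le> val e"
  using inst unfolding byzantine_instance_def by blast+

definition best :: "nat \<Rightarrow> (nat \<Rightarrow> real) \<Rightarrow> real" where
  "best k t = Max (insert 0 (val ` {e. e < n \<and> window m (t e) = k \<and> indep {e}}))"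

lemma best_nonneg: "0 \<le> best k t"
  by (simp add: best_def)

lemma best_ge: "e < n \<Longrightarrow> window m (t e) = k \<Longrightarrow> indep {e} \<Longrightarrow> val e \<le> best k t"
  unfolding best_def by (intro Max_ge) auto

lemma best_le:
  assumes "0 \<le> b" "\<And>e. e < n \<Longrightarrow> window m (t e) = k \<Longrightarrow> indep {e} \<Longrightarrow> val e \<le> b"
  shows "best k t \<le> b"
  unfolding best_def using assms by (intro Max.boundedI) auto

text \<open>The fixed set with which the prefix-dependent tests of the algorithm agree. The scale j
  of stage 0 ranges up to n inclusive, and j = n admits nothing.\<close>

definition candidates :: "nat \<Rightarrow> nat \<Rightarrow> (nat \<Rightarrow> real) \<Rightarrow> nat set" where
  "candidates k j t = (case k of
       0 \<Rightarrow> if j < n then {arrival_order n t ! j} else {}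
     | Suc k' \<Rightarrow> {e. e < n \<and> window m (t e) = k \<and> best k' t * 2 ^ j \<le> val e * 2 ^ num_scales n r k'})"

abbreviation selected :: "(nat \<Rightarrow> real) \<Rightarrow> real \<Rightarrow> nat set" where
  "selected t \<omega> \<equiv> matroid_selected (byzantine_algorithm n r) n indep val t \<omega>"

text \<open>The algorithm sees a prefix, whereas \<open>candidates\<close> refers to all arrivals.
  Both agree because an item of one window arrives only when the preceding window is over, so the
  estimate it is compared with is final.\<close>

lemma selected_greedy:
  assumes "prod_decode (nat \<lfloor>\<omega>\<rfloor>) = (k, j)"
  shows "indep (selected t \<omega>)"
    and "selected t \<omega> \<subseteq> candidates k j t"
    and "e \<in> candidates k j t \<Longrightarrow> e \<notin> selected t \<omega> \<Longrightarrow> \<not> indep (insert e (selected t \<omega>))"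
proof -
  define es where "es = arrival_order n t"
  have es: "length es = n" "set es = {..<n}" "distinct es" "sorted (map t es)"
    by (simp_all add: es_def arrival_order_props)
  have es_less: "es ! i < n" if "i < n" for i
    using nth_mem[of i es] that es by auto
  define ws where "ws l = map (\<lambda>e. (window m (t e), val e)) (take (Suc l) es)" for l
  define F where "F l = revealed_indep indep (take (Suc l) es)" for l
  define C where "C l = candidate (num_scales n r) k j (ws l) (F l)" for l
  define D where "D = (\<lambda>es. byzantine_algorithm n r \<omega> (history val t es) (revealed_indep indep es))"
  have selected_eq: "selected t \<omega> = online_selection es D"
    by (simp add: matroid_selected_def es_def D_def)
  have D_greedy: "D (take (Suc l) es) \<longleftrightarrow> l \<in> greedy (revealed_indep indep (take (Suc l) es)) (C l) (Suc l)"
    if "l < length es" for l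
  proof -
    have "length (take (Suc l) es) = Suc l"
      using that by simp
    moreover have "map (\<lambda>(t, v). (window m t, v)) (history val t (take (Suc l) es)) = ws l"
      by (simp only: history_def ws_def map_map o_def prod.case)
    ultimately show ?thesis
      unfolding D_def byzantine_algorithm_def assms prod.case C_def F_def
      by (simp only: history_def length_map diff_Suc_1)
  qed
  have C_iff: "C l i \<longleftrightarrow> es ! i \<in> candidates k j t" if l: "l < length es" "i \<le> l" for l i
  proof (cases k)
    case 0
    have "i = j \<longleftrightarrow> j < n \<and> es ! i = es ! j"
      using l nth_eq_iff_index_eq[OF es(3), of i j] unfolding es(1) by auto
    then show ?thesis
      unfolding C_def candidate_def candidates_def 0 es_def[symmetric] nat.case by auto
  next
    case (Suc k')
    have ws_nth: "ws l ! p = (window m (t (es ! p)), val (es ! p))" if "p \<le> l" for p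
      using that l by (simp add: ws_def)
    have len: "length (ws l) = Suc l"
      using l by (simp add: ws_def)
    have F_iff: "{p} \<in> F l \<longleftrightarrow> indep {es ! p}" if "p \<le> l" for p
      using that l by (simp add: F_def revealed_indep_def)
    have "estimate k' (ws l) (F l) = best k' t" if w: "window m (t (es ! i)) = k"
    proof -
      have "{snd (ws l ! p) |p. p < length (ws l) \<and> fst (ws l ! p) = k' \<and> {p} \<in> F l}
          = {val (es ! p) |p. p \<le> l \<and> window m (t (es ! p)) = k' \<and> indep {es ! p}}"
        unfolding len less_Suc_eq_le
        by (rule Collect_cong) (metis F_iff ws_nth fst_conv snd_conv)
      also have "\<dots> = val ` {e. e < n \<and> window m (t e) = k' \<and> indep {e}}"
      proof (intro equalityI subsetI)
        fix x assume "x \<in> val ` {e. e < n \<and> window m (t e) = k' \<and> indep {e}}"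
        then obtain e where e: "e < n" "window m (t e) = k'" "indep {e}" "x = val e"
          by blast
        then obtain p where p: "p < n" "e = es ! p"
          using es by (metis in_set_conv_nth lessThan_iff)
        \<comment> \<open>A position beyond l holds an item arriving no earlier than
          \<open>es ! i\<close>, hence in window \<open>Suc k'\<close> or later, not in window
          \<open>k'\<close>.\<close>
        have "p \<le> l"
        proof (rule ccontr)
          assume "\<not> p \<le> l"
          then have "t (es ! i) \<le> t (es ! p)"
            using sorted_nth_mono[OF es(4), of i p] l p es by simp
          then show False
            using window_mono[of "t (es ! i)" "t (es ! p)" m] e p w Suc by simp
        qed
        then show "x \<in> {val (es ! p) |p. p \<le> l \<and> window m (t (es ! p)) = k' \<and> indep {es ! p}}"
          using e p by blast
      qed (use l(1) es_less es(1) in fastforce)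
      finally show ?thesis
        by (simp add: estimate_def best_def)
    qed
    then show ?thesis
      using es_less[of i] l es(1)
      unfolding C_def candidate_def candidates_def Suc nat.case ws_nth[OF l(2)] fst_conv snd_conv
      by auto
  qed
  have sub: "candidates k j t \<subseteq> set es"
    using es_less unfolding es(2)
    by (auto simp: candidates_def es_def split: nat.splits if_splits)
  show "indep (selected t \<omega>)" "selected t \<omega> \<subseteq> candidates k j t"
    unfolding selected_eq
    by (rule online_selection_greedy[where C = C], fact indep_hered, fact indep_empty,
        erule D_greedy, erule (1) C_iff)+
  show "\<not> indep (insert e (selected t \<omega>))"
    if "e \<in> candidates k j t" "e \<notin> selected t \<omega>"
    unfolding selected_eq
    by (rule online_selection_greedy(3)[where C = C and K = "candidates k j t"],
        fact indep_hered, fact indep_empty, erule D_greedy, erule (1) C_iff)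
      (use that sub selected_eq in auto)
qed

lemma indep_selected: "indep (selected t \<omega>)"
  using selected_greedy(1)[of \<omega> "fst (prod_decode (nat \<lfloor>\<omega>\<rfloor>))" "snd (prod_decode (nat \<lfloor>\<omega>\<rfloor>))"] by simp

definition payoff :: "nat \<Rightarrow> nat \<Rightarrow> (nat \<Rightarrow> real) \<Rightarrow> real" where
  "payoff k j t = sum val (selected t (real (prod_encode (k, j))))"

lemma sum_val_selected_nonneg: "0 \<le> sum val (selected t \<omega>)"
  using indep_sub[OF indep_selected] by (intro sum_nonneg val_nonneg) auto

lemma payoff_nonneg: "0 \<le> payoff k j t"
  unfolding payoff_def by (rule sum_val_selected_nonneg)

text \<open>The selection is maximal among the candidates, hence at least as large as Y, and every
  selected item, green or red, is worth at least \<theta>.\<close>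

lemma payoff_ge_card:
  assumes "indep Y" "Y \<subseteq> candidates k j t" "0 \<le> \<theta>" "\<And>e. e \<in> candidates k j t \<Longrightarrow> \<theta> \<le> val e"
  shows "\<theta> * real (card Y) \<le> payoff k j t"
proof -
  let ?S = "selected t (real (prod_encode (k, j)))"
  have "prod_decode (nat \<lfloor>real (prod_encode (k, j))\<rfloor>) = (k, j)"
    by simp
  note S = selected_greedy[OF this, where t = t]
  have "card Y \<le> card ?S"
    by (rule matroid_card_le[OF matroid]) (use S assms in auto)
  then have "\<theta> * real (card Y) \<le> \<theta> * real (card ?S)"
    using assms by (intro mult_left_mono) auto
  also have "\<dots> \<le> sum val ?S"
    using sum_bounded_below[of ?S \<theta> val] S assms by (auto simp: mult.commute)
  finally show ?thesis
    by (simp add: payoff_def)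
qed

text \<open>One of the scales is the position of e. Summing over scales postpones their
  probabilities to the choice of the seed.\<close>

lemma payoff_stage_zero:
  assumes "e < n" "indep {e}"
  shows "val e \<le> (\<Sum>j\<le>n. payoff 0 j t)"
proof -
  obtain j where j: "j < n" "arrival_order n t ! j = e"
    using assms arrival_order_props by (metis in_set_conv_nth lessThan_iff)
  have "val e * real (card {e}) \<le> payoff 0 j t"
    by (rule payoff_ge_card) (use assms j val_nonneg in \<open>auto simp: candidates_def\<close>)
  also have "\<dots> \<le> (\<Sum>j\<le>n. payoff 0 j t)"
    using j by (intro member_le_sum payoff_nonneg) auto
  finally show ?thesis
    by simp
qed

definition threshold :: "nat \<Rightarrow> nat \<Rightarrow> (nat \<Rightarrow> real) \<Rightarrow> real" where
  "threshold k j t = best k t * 2 ^ j / 2 ^ num_scales n r k"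

lemma threshold_nonneg: "0 \<le> threshold k j t"
  by (simp add: threshold_def best_nonneg)

lemma candidates_Suc:
  "candidates (Suc k) j t = {e. e < n \<and> window m (t e) = Suc k \<and> threshold k j t \<le> val e}"
  by (auto simp: candidates_def threshold_def field_simps)

lemma payoff_ge_threshold:
  assumes "indep Y" "\<And>e. e \<in> Y \<Longrightarrow> window m (t e) = Suc k \<and> threshold k j t \<le> val e"
  shows "threshold k j t * real (card Y) \<le> payoff (Suc k) j t"
  by (rule payoff_ge_card)
    (use assms indep_sub[OF assms(1)] threshold_nonneg in \<open>auto simp: candidates_Suc\<close>)

end

subsection \<open>Arrival times and measurability\<close>

abbreviation unit_uniform :: "real measure" where
  "unit_uniform \<equiv> uniform_measure lborel {0..1}"

abbreviation green_times :: "nat set \<Rightarrow> (nat \<Rightarrow> real) measure" where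
  "green_times G \<equiv> \<Pi>\<^sub>M e\<in>G. unit_uniform"

lemma prob_space_unit_uniform: "prob_space unit_uniform"
  by (rule prob_space_uniform_measure) auto

lemma prob_space_green_times: "prob_space (green_times G)"
  by (rule prob_space_PiM) (rule prob_space_unit_uniform)

lemma interval_prob:
  assumes "0 \<le> a" "a \<le> b" "b \<le> 1" "{a..<b} \<subseteq> {x. window m x = k}"
  shows "b - a \<le> measure unit_uniform {x. window m x = k}"
proof -
  interpret prob_space unit_uniform
    by (rule prob_space_unit_uniform)
  have "{0..1} \<inter> {a..<b} = {a..<b}"
    using assms by auto
  then have "b - a = measure unit_uniform {a..<b}"
    using assms by (subst measure_uniform_measure) auto
  also have "\<dots> \<le> measure unit_uniform {x. window m x = k}"
    using assms(4) by (intro finite_measure_mono) auto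
  finally show ?thesis .
qed

lemma window_prob_less:
  assumes "k < m"
  shows "1 / (2 * real m) \<le> measure unit_uniform {x. window m x = k}"
proof -
  have "window m x = k" if "real k / (2 * real m) \<le> x" "x < (real k + 1) / (2 * real m)" for x
  proof -
    have x: "real k \<le> 2 * real m * x" "2 * real m * x < real k + 1"
      using that assms by (auto simp: field_simps)
    have "real k + 1 \<le> real m"
      using assms by linarith
    then have "2 * real m * x < real m"
      using x by linarith
    then have "x < 1/2"
      using mult_left_mono[of "1/2" x "2 * real m"] by (cases "x < 1/2") auto
    moreover have "\<lfloor>2 * real m * x\<rfloor> = int k"
      using x by (intro floor_unique) auto
    ultimately show ?thesis
      using assms by (auto simp: window_def)
  qed
  then have "(real k + 1) / (2 * real m) - real k / (2 * real m)
      \<le> measure unit_uniform {x. window m x = k}"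
    using assms by (intro interval_prob) (auto simp: field_simps)
  then show ?thesis
    by (simp add: diff_divide_distrib[symmetric] del: measure_uniform_measure)
qed

lemma window_prob_late:
  assumes "k = m \<or> k = Suc m"
  shows "1 / 4 \<le> measure unit_uniform {x. window m x = k}"
proof -
  have "{1/2..<3/4} \<subseteq> {x. window m x = m}" "{3/4..<1} \<subseteq> {x. window m x = Suc m}"
    by (auto simp: window_def)
  from interval_prob[OF _ _ _ this(1)] interval_prob[OF _ _ _ this(2)] show ?thesis
    using assms by (auto simp del: measure_uniform_measure)
qed

definition window_event :: "nat \<Rightarrow> nat set \<Rightarrow> nat set \<Rightarrow> (nat \<Rightarrow> nat) \<Rightarrow> (nat \<Rightarrow> real) set" where
  "window_event m G H \<kappa> = {u \<in> space (green_times G). \<forall>h\<in>H. window m (u h) = \<kappa> h}"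

lemma window_event_sets [measurable]:
  assumes "finite H" "H \<subseteq> G"
  shows "window_event m G H \<kappa> \<in> sets (green_times G)"
proof -
  have [measurable]: "(\<lambda>u. u h) \<in> borel_measurable (green_times G)" if "h \<in> H" for h
    using measurable_component_singleton[of h G "\<lambda>_. unit_uniform"] assms that
    by (auto simp: measurable_def)
  have "{u \<in> space (green_times G). \<forall>h\<in>H. window m (u h) = \<kappa> h} \<in> sets (green_times G)"
    by (rule sets.sets_Collect_finite_All) (use assms in measurable)
  then show ?thesis
    by (simp add: window_event_def)
qed

text \<open>Independence of the green arrival times. H is a set, so coinciding items contribute one
  factor only.\<close>

lemma window_event_prob:
  assumes "finite H" "H \<subseteq> G" "\<And>h. h \<in> H \<Longrightarrow> 0 \<le> p h"
    and "\<And>h. h \<in> H \<Longrightarrow> p h \<le> measure unit_uniform {x. window m x = \<kappa> h}"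
  shows "prod p H \<le> measure (green_times G) (window_event m G H \<kappa>)"
proof -
  interpret U: prob_space unit_uniform
    by (rule prob_space_unit_uniform)
  interpret product_prob_space "\<lambda>_. unit_uniform" G
    by unfold_locales
  have "emeasure (green_times G) (window_event m G H \<kappa>)
      = (\<Prod>h\<in>H. emeasure unit_uniform {x. window m x = \<kappa> h})"
    unfolding window_event_def
    using emeasure_PiM_Collect[of H "\<lambda>h. {x. window m x = \<kappa> h}"] assms by simp
  then have "measure (green_times G) (window_event m G H \<kappa>)
      = (\<Prod>h\<in>H. measure unit_uniform {x. window m x = \<kappa> h})"
    by (simp add: U.emeasure_eq_measure emeasure_eq_measure prod_ennreal prod_nonneg
        del: emeasure_uniform_measure measure_uniform_measure)
  also have "\<dots> \<ge> prod p H"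
    using assms by (intro prod_mono) auto
  finally show ?thesis .
qed

section \<open>Measurability of the arrival order and of the payoff\<close>

lemma measurable_insort_key:
  assumes [measurable]: "\<And>x. x \<in> A \<Longrightarrow> (\<lambda>u. t u x :: real) \<in> borel_measurable M"
    and "x \<in> A"
  shows "set ys \<subseteq> A \<Longrightarrow> (\<lambda>u. insort_key (t u) x ys) \<in> M \<rightarrow>\<^sub>M count_space UNIV"
proof (induction ys)
  case (Cons y ys)
  have "(\<lambda>u. y # insort_key (t u) x ys) \<in> M \<rightarrow>\<^sub>M count_space UNIV"
    by (rule measurable_compose[where g = "(#) y", OF Cons.IH]) (use Cons.prems in auto)
  moreover have "Measurable.pred M (\<lambda>u. t u x \<le> t u y)"
    using assms Cons.prems by auto
  ultimately show ?case
    by simp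
qed simp

lemma measurable_sort_key:
  assumes "\<And>x. x \<in> A \<Longrightarrow> (\<lambda>u. t u x :: real) \<in> borel_measurable M"
  shows "set xs \<subseteq> A \<Longrightarrow> (\<lambda>u. sort_key (t u) (xs :: nat list)) \<in> M \<rightarrow>\<^sub>M count_space UNIV"
proof (induction xs)
  case (Cons x xs)
  have "(\<lambda>u. insort_key (t u) x (sort_key (t u) xs)) \<in> M \<rightarrow>\<^sub>M count_space UNIV"
  proof (rule measurable_compose_countable'[where g = "\<lambda>u. sort_key (t u) xs" and I = "lists A"
        and f = "\<lambda>ys u. insort_key (t u) x ys"])
    show "(\<lambda>u. sort_key (t u) xs) \<in> M \<rightarrow>\<^sub>M count_space (lists A)"
    proof (rule measurable_count_space_eq2_countable[THEN iffD2], intro conjI ballI funcsetI)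
      show "(\<lambda>u. sort_key (t u) xs) -` {ys} \<inter> space M \<in> sets M" for ys
        using Cons by (intro measurable_sets[where A = "count_space UNIV"]) auto
    qed (use Cons.prems in auto)
    show "(\<lambda>u. insort_key (t u) x ys) \<in> M \<rightarrow>\<^sub>M count_space UNIV" if "ys \<in> lists A" for ys
      by (rule measurable_insort_key[where A = A]) (use assms Cons.prems that in auto)
  qed auto
  then show ?case
    by simp
qed simp

lemma measurable_map_list:
  assumes "\<And>x. x \<in> set xs \<Longrightarrow> (\<lambda>u. f u x :: nat) \<in> M \<rightarrow>\<^sub>M count_space UNIV"
  shows "(\<lambda>u. map (f u) xs) \<in> M \<rightarrow>\<^sub>M count_space UNIV"
  using assms
proof (induction xs)
  case (Cons x xs)
  have "(\<lambda>u. f u x # map (f u) xs) \<in> M \<rightarrow>\<^sub>M count_space UNIV"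
  proof (rule measurable_compose_countable[where g = "\<lambda>u. f u x" and f = "\<lambda>y u. y # map (f u) xs"])
    show "(\<lambda>u. y # map (f u) xs) \<in> M \<rightarrow>\<^sub>M count_space UNIV" for y
      by (rule measurable_compose[where g = "(#) y", OF Cons.IH]) (use Cons.prems in auto)
  qed (use Cons.prems in auto)
  then show ?case
    by simp
qed simp

lemma measurable_arrival_time:
  assumes "sets R = sets borel"
  shows "(\<lambda>p. arrival_time G s (snd p) e) \<in> borel_measurable (outcomes R G)"
proof (cases "e \<in> G")
  case True
  have "(\<lambda>p. snd p e) \<in> outcomes R G \<rightarrow>\<^sub>M unit_uniform"
    unfolding outcomes_def
    using True by (intro measurable_compose[OF measurable_snd] measurable_component_singleton)
  then show ?thesis
    using True by (simp add: arrival_time_def measurable_def)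
qed (simp add: arrival_time_def)

lemma online_selection_cong:
  assumes "\<And>k. k < length es \<Longrightarrow> D (take (Suc k) es) = D' (take (Suc k) es)"
  shows "online_selection es D = online_selection es D'"
  using assms by (auto simp: online_selection_def)

context byzantine_matroid
begin

abbreviation total_payoff :: "real \<times> (nat \<Rightarrow> real) \<Rightarrow> real" where
  "total_payoff \<equiv> matroid_payoff (byzantine_algorithm n r) n indep G val s"

lemma total_payoff_eq: "total_payoff (\<omega>, u) = sum val (selected (arrival_time G s u) \<omega>)"
  by (simp add: matroid_payoff_def)

text \<open>The payoff depends only on the decoded seed, the arrival order and the window of each item,
  which take countably many values.\<close>

lemma total_payoff_measurable:
  assumes R: "sets R = sets borel"
  shows "total_payoff \<in> borel_measurable (outcomes R G)"
proof -
  define t where "t p = arrival_time G s (snd p)" for p :: "real \<times> (nat \<Rightarrow> real)"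
  \<comment> \<open>The decision of the algorithm in terms of countable data: \<open>wl\<close>
    lists the windows by item label and replaces the arrival times.\<close>
  define dec where "dec q wl es = (case prod_decode q of (k, j) \<Rightarrow>
      length es - 1 \<in> greedy (revealed_indep indep es)
        (candidate (num_scales n r) k j (map (\<lambda>e. (wl ! e, val e)) es) (revealed_indep indep es)) (length es))"
    for q :: nat and wl es :: "nat list"
  define \<Psi> where "\<Psi> = (\<lambda>q es wl. sum val (online_selection es (dec q wl)))"
  have eq: "total_payoff p = \<Psi> (nat \<lfloor>fst p\<rfloor>) (sort_key (t p) [0..<n]) (map (\<lambda>e. window m (t p e)) [0..<n])"
    for p
  proof -
    define es where "es = sort_key (t p) [0..<n]"
    let ?wl = "map (\<lambda>e. window m (t p e)) [0..<n]"
    have "byzantine_algorithm n r (fst p) (history val (t p) (take (Suc l) es))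
        (revealed_indep indep (take (Suc l) es)) = dec (nat \<lfloor>fst p\<rfloor>) ?wl (take (Suc l) es)" for l
    proof -
      have "map (\<lambda>(t, v). (window m t, v)) (history val (t p) (take (Suc l) es))
          = map (\<lambda>e. (?wl ! e, val e)) (take (Suc l) es)"
        by (auto simp: history_def es_def dest: in_set_takeD)
      moreover have "length (history val (t p) (take (Suc l) es)) = length (take (Suc l) es)"
        by (simp add: history_def)
      ultimately show ?thesis
        unfolding byzantine_algorithm_def dec_def by simp
    qed
    then have "online_selection es (\<lambda>es. byzantine_algorithm n r (fst p) (history val (t p) es)
        (revealed_indep indep es)) = online_selection es (dec (nat \<lfloor>fst p\<rfloor>) ?wl)"
      by (intro online_selection_cong)
    then show ?thesis
      unfolding \<Psi>_def es_def[symmetric]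
      by (cases p) (simp add: matroid_payoff_def matroid_selected_def arrival_order_def t_def es_def)
  qed
  have "(\<lambda>p. \<Psi> (nat \<lfloor>fst p\<rfloor>) (sort_key (t p) [0..<n]) (map (\<lambda>e. window m (t p e)) [0..<n]))
      \<in> borel_measurable (outcomes R G)"
  proof -
    have t [measurable]: "(\<lambda>p. t p e) \<in> borel_measurable (outcomes R G)" for e
      unfolding t_def using R by (rule measurable_arrival_time)
    have "fst \<in> borel_measurable (outcomes R G)"
      unfolding outcomes_def using R by (simp cong: measurable_cong_sets)
    then have 1: "(\<lambda>p. nat \<lfloor>fst p\<rfloor>) \<in> outcomes R G \<rightarrow>\<^sub>M count_space UNIV"
      by measurable
    have 2: "(\<lambda>p. sort_key (t p) [0..<n]) \<in> outcomes R G \<rightarrow>\<^sub>M count_space UNIV"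
      by (rule measurable_sort_key[where A = UNIV]) auto
    have 3: "(\<lambda>p. map (\<lambda>e. window m (t p e)) [0..<n]) \<in> outcomes R G \<rightarrow>\<^sub>M count_space UNIV"
      by (rule measurable_map_list) measurable
    show ?thesis
      by (rule measurable_compose_countable[OF _ 1, where f =
              "\<lambda>q p. \<Psi> q (sort_key (t p) [0..<n]) (map (\<lambda>e. window m (t p e)) [0..<n])"],
          rule measurable_compose_countable[OF _ 2, where f =
              "\<lambda>es p. \<Psi> _ es (map (\<lambda>e. window m (t p e)) [0..<n])"],
          rule measurable_compose[OF 3]) simp
  qed
  then show ?thesis
    unfolding eq[symmetric] .
qed

lemma total_payoff_nonneg: "0 \<le> total_payoff p"
  by (cases p) (simp add: total_payoff_eq sum_val_selected_nonneg)

lemma total_payoff_le: "total_payoff p \<le> sum val {..<n}"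
proof (cases p)
  case (Pair \<omega> u)
  then show ?thesis
    using indep_sub[OF indep_selected, of "arrival_time G s u" \<omega>]
    by (auto simp: total_payoff_eq intro!: sum_mono2 val_nonneg)
qed

lemma prob_space_outcomes:
  assumes "prob_space R"
  shows "prob_space (outcomes R G)"
proof -
  interpret R: prob_space R by fact
  interpret T: prob_space "green_times G" by (rule prob_space_green_times)
  interpret pair_prob_space R "green_times G" ..
  show ?thesis
    unfolding outcomes_def by (rule prob_space_axioms)
qed

lemma total_payoff_integrable:
  assumes "seed_distribution R"
  shows "integrable (outcomes R G) total_payoff"
proof -
  interpret prob_space "outcomes R G"
    using assms by (intro prob_space_outcomes) (simp add: seed_distribution_def)
  show ?thesis
    using assms total_payoff_measurable total_payoff_nonneg total_payoff_le
    by (intro integrable_const_bound[where B = "sum val {..<n}"])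
      (auto simp: seed_distribution_def abs_of_nonneg)
qed

end

subsection \<open>Distribution of the seed\<close>

text \<open>For uniform \<open>a < 3 (m + 1)\<close>, the first and the last stage have probability at least \<open>1/3\<close>, and
  every other stage has probability \<open>1 / (3 (m + 1))\<close>.\<close>

definition stage :: "nat \<Rightarrow> nat \<Rightarrow> nat" where
  "stage m a = (if a \<le> m then a else if a \<le> 2 * m + 1 then 0 else Suc m)"

definition max_seed :: "nat \<Rightarrow> nat \<Rightarrow> nat \<Rightarrow> nat" where
  "max_seed n r k = (case k of 0 \<Rightarrow> n | Suc k' \<Rightarrow> 2 * num_scales n r k')"

definition seed_pmf :: "nat \<Rightarrow> nat \<Rightarrow> nat pmf" where
  "seed_pmf n r = (let m = log_star (real n) in
     bind_pmf (pmf_of_set {..<3 * Suc m}) (\<lambda>a.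
       map_pmf (\<lambda>j. prod_encode (stage m a, j)) (pmf_of_set {..max_seed n r (stage m a)})))"

definition seed_measure :: "nat \<Rightarrow> nat \<Rightarrow> real measure" where
  "seed_measure n r = distr (measure_pmf (seed_pmf n r)) borel real"

lemma seed_distribution_seed_measure: "seed_distribution (seed_measure n r)"
  unfolding seed_distribution_def seed_measure_def
  by (simp add: measure_pmf.prob_space_distr)

lemma finite_set_seed_pmf: "finite (set_pmf (seed_pmf n r))"
  unfolding seed_pmf_def Let_def
  by (auto simp: set_pmf_of_set lessThan_empty_iff)

text \<open>S collects values of the uniform variable that lead to stage k. By injectivity of the
  coding each contributes the uniform probability of the scale j.\<close>

lemma pmf_seed_ge:
  assumes S: "S \<subseteq> {..<3 * Suc (log_star (real n))}"
    and stage: "\<And>a. a \<in> S \<Longrightarrow> stage (log_star (real n)) a = k"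
    and j: "j \<le> max_seed n r k"
  shows "real (card S) / (3 * real (Suc (log_star (real n))) * real (Suc (max_seed n r k)))
    \<le> pmf (seed_pmf n r) (prod_encode (k, j))"
proof -
  define m where "m = log_star (real n)"
  define f where "f a = pmf (map_pmf (\<lambda>j. prod_encode (stage m a, j))
      (pmf_of_set {..max_seed n r (stage m a)})) (prod_encode (k, j))" for a
  have f: "f a = 1 / real (Suc (max_seed n r k))" if "a \<in> S" for a
  proof -
    have "inj (\<lambda>j. prod_encode (k, j))"
      by (auto simp: inj_def)
    from pmf_map_inj'[OF this] have "f a = pmf (pmf_of_set {..max_seed n r k}) j"
      using stage[OF that] by (simp add: f_def m_def)
    then show ?thesis
      using j by (simp add: pmf_of_set)
  qed
  have "real (card S) / real (Suc (max_seed n r k)) = (\<Sum>a\<in>S. f a)"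
    by (simp add: f)
  also have "\<dots> \<le> (\<Sum>a\<in>{..<3 * Suc m}. f a)"
    using S by (intro sum_mono2) (auto simp: f_def m_def)
  finally have "real (card S) / real (Suc (max_seed n r k)) / (3 * real (Suc m))
      \<le> (\<Sum>a\<in>{..<3 * Suc m}. f a) / (3 * real (Suc m))"
    by (intro divide_right_mono) auto
  also have "\<dots> = pmf (seed_pmf n r) (prod_encode (k, j))"
    unfolding seed_pmf_def Let_def m_def[symmetric] f_def
    by (subst pmf_bind_pmf_of_set) (auto simp: lessThan_empty_iff)
  finally show ?thesis
    by (simp add: m_def mult_ac)
qed

lemma pmf_seed_zero:
  assumes "j \<le> n"
  shows "1 / (3 * real (Suc n)) \<le> pmf (seed_pmf n r) (prod_encode (0, j))"
proof -
  define m where "m = log_star (real n)"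
  have "real (card {Suc m..2 * m + 1}) / (3 * real (Suc m) * real (Suc (max_seed n r 0)))
      \<le> pmf (seed_pmf n r) (prod_encode (0, j))"
    unfolding m_def by (rule pmf_seed_ge) (use assms in \<open>auto simp: stage_def max_seed_def\<close>)
  moreover have "real (card {Suc m..2 * m + 1}) = real (Suc m)"
    by simp
  moreover have "real (Suc m) / (3 * real (Suc m) * x) = 1 / (3 * x)" for x :: real
    by (simp del: of_nat_Suc)
  ultimately show ?thesis
    by (simp only: max_seed_def nat.case)
qed

lemma pmf_seed_refine:
  assumes "k < log_star (real n)" "j \<le> 2 * num_scales n r k"
  shows "1 / (3 * real (Suc (log_star (real n))) * real (Suc (2 * num_scales n r k)))
    \<le> pmf (seed_pmf n r) (prod_encode (Suc k, j))"
  using pmf_seed_ge[of "{Suc k}" n "Suc k" j r] assms by (auto simp: stage_def max_seed_def)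

lemma pmf_seed_last:
  assumes "j \<le> 2 * num_scales n r (log_star (real n))"
  shows "1 / (3 * real (Suc (2 * num_scales n r (log_star (real n)))))
    \<le> pmf (seed_pmf n r) (prod_encode (Suc (log_star (real n)), j))"
proof -
  define m where "m = log_star (real n)"
  have "real (card {2 * m + 2..<3 * Suc m}) / (3 * real (Suc m) * real (Suc (max_seed n r (Suc m))))
      \<le> pmf (seed_pmf n r) (prod_encode (Suc m, j))"
    unfolding m_def by (rule pmf_seed_ge) (use assms in \<open>auto simp: stage_def max_seed_def\<close>)
  moreover have "real (card {2 * m + 2..<3 * Suc m}) = real (Suc m)"
    by simp
  moreover have "real (Suc m) / (3 * real (Suc m) * x) = 1 / (3 * x)" for x :: real
    by (simp del: of_nat_Suc)
  ultimately show ?thesis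
    by (simp only: max_seed_def nat.case m_def)
qed

section \<open>From pointwise payoffs to the expected payoff\<close>

context byzantine_matroid
begin

abbreviation expected_payoff :: real where
  "expected_payoff \<equiv> integral\<^sup>L (outcomes (seed_measure n r) G) total_payoff"

text \<open>Fubini: for each seed of stage k the payoff is averaged over the green times, and each
  seed has probability at least w. The events \<open>B i\<close> record favourable windows, with
  guaranteed gains \<open>x i\<close>.\<close>

lemma expected_payoff_ge:
  assumes w: "0 \<le> w" "\<And>j. j \<le> J \<Longrightarrow> w \<le> pmf (seed_pmf n r) (prod_encode (k, j))"
    and I: "finite I" "\<And>i. i \<in> I \<Longrightarrow> B i \<in> sets (green_times G)"
    and le: "\<And>u. u \<in> space (green_times G) \<Longrightarrow>
      (\<Sum>i\<in>I. x i * indicator (B i) u) \<le> (\<Sum>j\<le>J. payoff k j (arrival_time G s u))"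
  shows "w * (\<Sum>i\<in>I. x i * measure (green_times G) (B i)) \<le> expected_payoff"
proof -
  let ?R = "seed_measure n r" and ?P = "green_times G" and ?p = "seed_pmf n r"
  define g where "g \<omega> = (\<integral>u. total_payoff (\<omega>, u) \<partial>?P)" for \<omega>
  have R: "prob_space ?R" "sets ?R = sets borel"
    using seed_distribution_seed_measure[of n r] by (simp_all add: seed_distribution_def)
  interpret R: prob_space ?R by fact
  interpret T: prob_space ?P by (rule prob_space_green_times)
  interpret pair_prob_space ?R ?P ..
  have int: "integrable (?R \<Otimes>\<^sub>M ?P) total_payoff"
    using total_payoff_integrable[OF seed_distribution_seed_measure] by (simp add: outcomes_def)
  have int_u: "integrable ?P (\<lambda>u. total_payoff (\<omega>, u))" for \<omega>
  proof (rule T.integrable_const_bound[where B = "sum val {..<n}"])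
    have "\<omega> \<in> space ?R"
      by (simp add: seed_measure_def)
    then show "(\<lambda>u. total_payoff (\<omega>, u)) \<in> borel_measurable ?P"
      by (intro measurable_compose[OF measurable_Pair1' borel_measurable_integrable[OF int]])
  qed (use total_payoff_nonneg total_payoff_le in \<open>auto simp: abs_of_nonneg\<close>)
  have g_nonneg: "0 \<le> g \<omega>" for \<omega>
    unfolding g_def using total_payoff_nonneg by (intro integral_nonneg_AE) auto
  have g_meas: "g \<in> borel_measurable borel"
    using borel_measurable_integrable[OF integrable_fst'[OF int]] R(2)
    unfolding g_def by (simp cong: measurable_cong_sets)
  define Q where "Q = (\<lambda>j. prod_encode (k, j)) ` {..J}"
  have inj: "inj_on (\<lambda>j. prod_encode (k, j)) {..J}"
    by (auto simp: inj_on_def)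
  have int_B: "integrable ?P (\<lambda>u. x i * indicator (B i) u)" if "i \<in> I" for i
    using I(2)[OF that] by (intro integrable_mult_right integrable_real_indicator)
      (auto simp: T.emeasure_eq_measure)
  have "(\<Sum>i\<in>I. x i * measure ?P (B i)) = (\<Sum>i\<in>I. \<integral>u. x i * indicator (B i) u \<partial>?P)"
    using I(2) sets.sets_into_space by (intro sum.cong) (auto simp: Int_absorb2)
  also have "\<dots> = (\<integral>u. (\<Sum>i\<in>I. x i * indicator (B i) u) \<partial>?P)"
    using int_B by (intro Bochner_Integration.integral_sum[symmetric])
  also have "\<dots> \<le> (\<integral>u. (\<Sum>j\<le>J. total_payoff (real (prod_encode (k, j)), u)) \<partial>?P)"
  proof (rule integral_mono)
    show "integrable ?P (\<lambda>u. \<Sum>i\<in>I. x i * indicator (B i) u)"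
      by (intro Bochner_Integration.integrable_sum int_B)
    show "integrable ?P (\<lambda>u. \<Sum>j\<le>J. total_payoff (real (prod_encode (k, j)), u))"
      by (intro Bochner_Integration.integrable_sum int_u)
  qed (use le in \<open>simp add: payoff_def total_payoff_eq del: mult_indicator_subset sum_mult_indicator\<close>)
  also have "\<dots> = (\<Sum>j\<le>J. g (real (prod_encode (k, j))))"
    unfolding g_def using int_u by (intro Bochner_Integration.integral_sum) auto
  finally have "w * (\<Sum>i\<in>I. x i * measure ?P (B i)) \<le> (\<Sum>j\<le>J. w * g (real (prod_encode (k, j))))"
    using w(1) by (simp add: sum_distrib_left[symmetric] mult_left_mono)
  also have "\<dots> \<le> (\<Sum>j\<le>J. g (real (prod_encode (k, j))) * pmf ?p (prod_encode (k, j)))"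
    unfolding mult.commute[of "g _"] using w(2) g_nonneg by (intro sum_mono mult_right_mono) auto
  also have "\<dots> = (\<Sum>q\<in>Q. g (real q) * pmf ?p q)"
    unfolding Q_def by (subst sum.reindex[OF inj]) simp
  \<comment> \<open>All other seeds are added, with nonnegative payoff.\<close>
  also have "\<dots> \<le> (\<Sum>q\<in>Q \<union> set_pmf ?p. g (real q) * pmf ?p q)"
    using g_nonneg finite_set_seed_pmf by (intro sum_mono2) (auto simp: Q_def)
  also have "\<dots> = (\<integral>q. g (real q) \<partial>measure_pmf ?p)"
    using finite_set_seed_pmf by (intro integral_measure_pmf_real[symmetric]) (auto simp: Q_def)
  also have "\<dots> = (\<integral>\<omega>. g \<omega> \<partial>?R)"
    unfolding seed_measure_def using g_meas by (intro integral_distr[symmetric]) auto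
  also have "\<dots> = expected_payoff"
    unfolding g_def outcomes_def by (rule integral_fst'[OF int])
  finally show ?thesis .
qed

end

subsection \<open>Refining the estimate\<close>

lemma doubling_scale:
  fixes f :: "nat \<Rightarrow> real"
  assumes "f 0 \<le> x" "x < f N" and double: "\<And>j. f (Suc j) = 2 * f j"
  obtains j where "j \<le> N" "f j \<le> x" "x < 2 * f j"
proof -
  have "\<exists>j\<le>N. f j \<le> x \<and> x < 2 * f j"
    using assms(2)
  proof (induction N)
    case (Suc N)
    then show ?case
      using double[of N] by (cases "x < f N") (auto intro: le_SucI)
  qed (use assms(1) in simp)
  then show ?thesis
    using that by blast
qed

lemma ratio_bound_ge_one: "1 \<le> ratio_bound n k"
  using mult_mono[of 1 "4 ^ log_star (real n)" 1 "level n k"] level_ge_one[of n k]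
  by (simp add: ratio_bound_def)

lemma ratio_bound_Suc_le: "k < log_star (real n) \<Longrightarrow> ratio_bound n (Suc k) \<le> ratio_bound n k"
  using level_Suc_le[of k n] by (simp add: ratio_bound_def)

lemma num_scales_ge:
  assumes "1 \<le> r"
  shows "4 * real r * ratio_bound n k \<le> 2 ^ num_scales n r k"
proof -
  let ?x = "4 * real r * ratio_bound n k"
  have x: "0 < ?x"
    using assms ratio_bound_ge_one[of n k] by auto
  have "log 2 ?x \<le> real (num_scales n r k)"
    unfolding num_scales_def by linarith
  then have "?x \<le> 2 powr real (num_scales n r k)"
    using x by (subst (asm) log_le_iff) auto
  then show ?thesis
    by (simp add: powr_realpow)
qed

text \<open>L is kept free: a refinement step takes the level of the next stage, the last stage
  takes 1.\<close>

lemma num_scales_le: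
  assumes "1 \<le> r" "0 < log_star (real n)" "log 2 (level n k) \<le> L" "1 \<le> L"
  shows "real (Suc (2 * num_scales n r k)) \<le> 15 * real (log_star (real n)) * max 1 (log 2 (real r)) * L"
proof -
  define m where "m = real (log_star (real n))"
  define lr where "lr = max 1 (log 2 (real r))"
  have pos: "0 < level n k"
    using level_ge_one[of n k] by simp
  have "log 2 (4 * real r * ratio_bound n k) = log 2 4 + log 2 (real r) + (log 2 (4 ^ log_star (real n)) + log 2 (level n k))"
    unfolding ratio_bound_def using assms pos by (simp add: log_mult)
  also have "log 2 (4 ^ log_star (real n)) = m * log 2 4"
    by (simp add: log_nat_power m_def)
  also have "log 2 4 = (2::real)"
    using log_pow_cancel[of 2 2] by simp
  finally have "log 2 (4 * real r * ratio_bound n k) \<le> 2 + lr + (m * 2 + L)"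
    using assms(3) by (simp add: lr_def)
  moreover have ge: "1 \<le> m" "1 \<le> lr" "1 \<le> L"
    using assms by (auto simp: m_def lr_def)
  ultimately have "real (num_scales n r k) \<le> 3 + lr + (m * 2 + L)"
    unfolding num_scales_def by linarith
  then have "real (Suc (2 * num_scales n r k)) \<le> 7 + 2 * lr + 4 * m + 2 * L"
    by simp
  \<comment> \<open>All factors are at least 1, so 1, lr, m and L are each at most the product, and
    7 + 2 + 4 + 2 = 15.\<close>
  also have "\<dots> \<le> 15 * (m * lr * L)"
  proof -
    have "1 \<le> m * lr" 
      using mult_mono[of 1 m 1 lr] ge by simp
    then have "1 * 1 \<le> m * lr * L" "1 * L \<le> m * lr * L"
      using ge by (intro mult_mono; simp)+
    moreover have "1 * lr * 1 \<le> m * lr * L" "m * 1 * 1 \<le> m * lr * L"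
      using ge by (intro mult_mono; simp)+
    ultimately show ?thesis
      by simp
  qed
  finally show ?thesis
    by (simp add: m_def lr_def)
qed

section \<open>Instances with a positive benchmark\<close>

locale byzantine_benchmark = byzantine_matroid +
  fixes g h :: nat and V :: real and Opt :: "nat set"
  assumes n_ge: "2 \<le> n"
    and g: "most_valuable val (non_loops indep G) g"
    and V: "V = matroid_opt indep val (G - {g})" "0 < V"
    and Opt: "indep Opt" "Opt \<subseteq> G - {g}" "sum val Opt = V"
    and h: "h \<in> Opt" "V \<le> real r * val h"
begin

lemma m_pos: "0 < m"
  using n_ge by (rule log_star_pos)

lemma g_mem: "g \<in> G" "indep {g}"
  using g unfolding most_valuable_def non_loops_def by blast+

lemma r_pos: "1 \<le> r"
  using card_indep_le[OF g_mem(2)] by simp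

lemma Opt_nonloop: "e \<in> Opt \<Longrightarrow> indep {e}"
  using indep_hered[OF Opt(1), of "{e}"] by simp

lemma val_le_g: "e \<in> G \<Longrightarrow> indep {e} \<Longrightarrow> val e \<le> val g"
  using g unfolding most_valuable_def non_loops_def by blast

lemma val_le_V:
  assumes "e \<in> G" "e \<noteq> g" "indep {e}"
  shows "val e \<le> V"
proof -
  have "finite {I. indep I \<and> I \<subseteq> G - {g}}"
    by (rule finite_subset[OF _ finite_indep]) auto
  then have "sum val {e} \<le> V"
    unfolding V(1) matroid_opt_def using assms by (intro Max_ge finite_imageI imageI) auto
  then show ?thesis
    by simp
qed

lemma h_mem: "h \<in> G" "h \<noteq> g" "indep {h}"
  using h(1) Opt(2) Opt_nonloop[of h] by auto

text \<open>The invariant carried from window to window. It is not a random event, because the red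
  arrival times are fixed.\<close>

definition reds_bounded :: "nat \<Rightarrow> bool" where
  "reds_bounded k \<longleftrightarrow>
     (\<forall>e<n. e \<notin> G \<longrightarrow> indep {e} \<longrightarrow> window m (s e) = k \<longrightarrow> val e \<le> ratio_bound n k * V)"

text \<open>With h in window k the estimate is at least V / r. With g in the last window all green
  non-loops of window k are worth at most V, so the estimate is at most
  \<open>ratio_bound n k * V\<close>. The thresholds double from below V / (4 r) to above this
  bound, so one of them is within a factor 2 of x.\<close>

lemma threshold_exists:
  assumes k: "k \<le> m" "reds_bounded k"
    and u: "window m (u h) = k" "window m (u g) = Suc m"
    and x: "V / (4 * real r) \<le> x" "x \<le> ratio_bound n k * V"
  obtains j where "j \<le> 2 * num_scales n r k"
    "threshold k j (arrival_time G s u) \<le> x" "x < 2 * threshold k j (arrival_time G s u)"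
proof -
  let ?t = "arrival_time G s u" and ?J = "num_scales n r k" and ?T = "ratio_bound n k"
  let ?b = "best k ?t"
  have T: "1 \<le> ?T"
    by (rule ratio_bound_ge_one)
  have r: "0 < real r"
    using r_pos by simp
  have J: "4 * real r * ?T \<le> 2 ^ ?J"
    using num_scales_ge[OF r_pos] .
  have "val h \<le> ?b"
    using h_mem G_sub u by (intro best_ge) (auto simp: arrival_time_def)
  then have "real r * val h \<le> real r * ?b"
    by (intro mult_left_mono) auto
  with h(2) have lower: "V \<le> real r * ?b"
    by linarith
  have upper: "?b \<le> ?T * V"
  proof (rule best_le)
    have "V \<le> ?T * V"
      using T V(2) mult_right_mono[of 1 ?T V] by simp
    then show "val e \<le> ?T * V" if "e < n" "window m (?t e) = k" "indep {e}" for e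
    proof (cases "e \<in> G")
      case True
      then have "e \<noteq> g"
        using that u k by (auto simp: arrival_time_def)
      then show ?thesis
        using val_le_V[OF True] that \<open>V \<le> ?T * V\<close> by linarith
    next
      case False
      then show ?thesis
        using k(2) that by (auto simp: reds_bounded_def arrival_time_def)
    qed
  qed (use T V in auto)
  have "threshold k 0 ?t \<le> x"
  proof -
    have "?b * (4 * real r) \<le> ?T * V * (4 * real r)"
      using upper r by (intro mult_right_mono) auto
    also have "\<dots> = (4 * real r * ?T) * V"
      by (simp add: mult_ac)
    also have "\<dots> \<le> 2 ^ ?J * V"
      using J V(2) by (intro mult_right_mono) auto
    finally have "threshold k 0 ?t \<le> V / (4 * real r)"
      using r by (simp add: threshold_def field_simps)
    with x(1) show ?thesis
      by linarith
  qed
  moreover have "x < threshold k (2 * ?J) ?t"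
  proof -
    have "?T * V < 4 * (?T * V)"
      using T V(2) by simp
    also have "\<dots> \<le> 4 * (?T * (real r * ?b))"
      using lower T by (intro mult_left_mono) auto
    also have "\<dots> = (4 * real r * ?T) * ?b"
      by (simp add: mult_ac)
    also have "\<dots> \<le> 2 ^ ?J * ?b"
      using J best_nonneg by (intro mult_right_mono) auto
    also have "\<dots> = threshold k (2 * ?J) ?t"
      by (simp add: threshold_def mult_2 power_add)
    finally show ?thesis
      using x(2) by linarith
  qed
  moreover have "threshold k (Suc j) ?t = 2 * threshold k j ?t" for j
    by (simp add: threshold_def)
  ultimately obtain j where "j \<le> 2 * ?J" "threshold k j ?t \<le> x" "x < 2 * threshold k j ?t"
    by (rule doubling_scale[where f = "\<lambda>j. threshold k j ?t"]) auto
  then show ?thesis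
    by (rule that)
qed

text \<open>The favourable windows: h feeds the estimate, all other green items under consideration
  wait for the last window.\<close>

definition window_of_green :: "nat \<Rightarrow> nat \<Rightarrow> nat" where
  "window_of_green k e = (if e = h then k else Suc m)"

text \<open>Stage 0 has probability at least 1/3 and then hits the position of e with probability 1
  / (n + 1). The gain follows from n / (n + 1) \<ge> 1/2.\<close>

lemma huge_item_suffices:
  assumes "e < n" "indep {e}" "real n * V < val e"
  shows "V / 6 \<le> expected_payoff"
proof -
  interpret T: prob_space "green_times G" by (rule prob_space_green_times)
  \<comment> \<open>No green arrival time is constrained, so a single event, the whole space, is
    used.\<close>
  have "1 / (3 * real (Suc n)) * (\<Sum>i\<in>{()}. val e * measure (green_times G) (space (green_times G)))
      \<le> expected_payoff"
    by (rule expected_payoff_ge[where k = 0 and J = n])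
      (use pmf_seed_zero payoff_stage_zero[OF assms(1,2)] in auto)
  then have "1 / (3 * real (Suc n)) * val e \<le> expected_payoff"
    by (simp add: T.prob_space)
  moreover have "V / 6 \<le> 1 / (3 * real (Suc n)) * (real n * V)"
    using n_ge V(2) by (simp add: field_simps)
  moreover have "1 / (3 * real (Suc n)) * (real n * V) \<le> 1 / (3 * real (Suc n)) * val e"
    using assms(3) by (intro mult_left_mono) auto
  ultimately show ?thesis
    by linarith
qed

text \<open>The constant comes from the last stage: 15360 = 3 * 15 * 1024 / 3. The other cases give
  smaller constants.\<close>

abbreviation target :: real where
  "target \<equiv> V / (15360 * (real m * max 1 (log 2 (real r))))"

text \<open>Some red e in window k + 1 violates the bound there. If h and g fall into their windows,
  some scale gives a threshold that e passes and that exceeds half the violated bound. In that bound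
  the factor \<open>level n (Suc k)\<close> pays for the number of scales, and 4 ^ m pays for the
  further factors m.\<close>

lemma refinement_suffices:
  assumes k: "k < m" "reds_bounded k" "\<not> reds_bounded (Suc k)"
  shows "target \<le> expected_payoff"
proof -
  let ?T = "ratio_bound n (Suc k)" and ?J = "num_scales n r k"
  let ?E = "window_event m G {h, g} (window_of_green k)"
  define w where "w = 1 / (3 * real (Suc m) * real (Suc (2 * ?J)))"
  obtain e where e: "e < n" "e \<notin> G" "indep {e}" "window m (s e) = Suc k" "?T * V < val e"
    using k(3) by (auto simp: reds_bounded_def not_le)
  have "w * (\<Sum>i\<in>{()}. ?T * V / 2 * measure (green_times G) ?E) \<le> expected_payoff"
  proof (rule expected_payoff_ge[where k = "Suc k" and J = "2 * ?J"])
    show "w \<le> pmf (seed_pmf n r) (prod_encode (Suc k, j))" if "j \<le> 2 * ?J" for j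
      unfolding w_def using k(1) that by (rule pmf_seed_refine)
    show "?E \<in> sets (green_times G)"
      using g_mem h_mem by (intro window_event_sets) auto
    fix u assume u: "u \<in> space (green_times G)"
    let ?t = "arrival_time G s u"
    show "(\<Sum>i\<in>{()}. ?T * V / 2 * indicator ?E u) \<le> (\<Sum>j\<le>2 * ?J. payoff (Suc k) j ?t)"
    proof (cases "u \<in> ?E")
      case True
      then have u_win: "window m (u h) = k" "window m (u g) = Suc m"
        using h_mem by (auto simp: window_event_def window_of_green_def)
      have "1 \<le> ?T" "?T \<le> ratio_bound n k"
        using ratio_bound_ge_one ratio_bound_Suc_le[OF k(1)] by auto
      then have "V \<le> ?T * V" "?T * V \<le> ratio_bound n k * V"
        using V(2) mult_right_mono[of 1 ?T V] by auto
      moreover have "V / (4 * real r) \<le> V"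
        using r_pos V(2) by (simp add: field_simps)
      ultimately obtain j where j: "j \<le> 2 * ?J" "threshold k j ?t \<le> ?T * V" "?T * V < 2 * threshold k j ?t"
        using threshold_exists[OF less_imp_le[OF k(1)] k(2) u_win, of "?T * V"] by auto
      have "threshold k j ?t * real (card {e}) \<le> payoff (Suc k) j ?t"
        using e j by (intro payoff_ge_threshold) (auto simp: arrival_time_def)
      also have "\<dots> \<le> (\<Sum>j\<le>2 * ?J. payoff (Suc k) j ?t)"
        using j by (intro member_le_sum payoff_nonneg) auto
      finally show ?thesis
        using j True by simp
    qed (simp add: sum_nonneg payoff_nonneg)
  qed (auto simp: w_def)
  \<comment> \<open>Factor 1 / (2 m) for h in window k, and 1/4 for g in the last window.\<close>
  moreover have "1 / (8 * real m) \<le> measure (green_times G) ?E"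
  proof -
    define p where "p e = (if e = h then 1 / (2 * real m) else 1 / 4)" for e
    have "prod p {h, g} \<le> measure (green_times G) ?E"
      using window_prob_less[OF k(1)] window_prob_late[of "Suc m" m] g_mem h_mem
      by (intro window_event_prob) (auto simp: p_def window_of_green_def simp del: measure_uniform_measure)
    then show ?thesis
      using h_mem by (simp add: p_def)
  qed
  moreover have "0 \<le> w * (?T * V / 2)"
    using ratio_bound_ge_one[of n "Suc k"] V(2) by (simp add: w_def)
  ultimately have ge: "w * (?T * V / 2) * (1 / (8 * real m)) \<le> expected_payoff"
    using mult_left_mono[of "1 / (8 * real m)" "measure (green_times G) ?E" "w * (?T * V / 2)"]
    by (simp add: mult_ac)
  define L lr M where "L = level n (Suc k)" and "lr = max 1 (log 2 (real r))" and "M = real m"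
  have pos: "1 \<le> L" "1 \<le> lr" "1 \<le> M"
    using level_ge_one m_pos by (auto simp: L_def lr_def M_def)
  \<comment> \<open>The extra loss of m squared is absorbed by 4 ^ m, since m < 2 ^ m.\<close>
  have "M * M \<le> 2 ^ m * 2 ^ m"
    unfolding M_def using less_exp[of m] by (intro mult_mono) (auto simp: less_imp_le)
  then have M4: "M * M \<le> 4 ^ m"
    by (simp add: power_mult_distrib[symmetric])
  have "3 * real (Suc m) * real (Suc (2 * ?J)) \<le> (6 * M) * (15 * M * lr * L)"
  proof (rule mult_mono)
    show "3 * real (Suc m) \<le> 6 * M"
      using pos by (simp add: M_def)
    show "real (Suc (2 * ?J)) \<le> 15 * M * lr * L"
      unfolding M_def lr_def L_def by (rule num_scales_le[OF r_pos m_pos log_level_le level_ge_one])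
  qed (use pos in auto)
  then have "1 / (90 * (M * M * lr * L)) \<le> w"
    unfolding w_def using pos by (intro divide_left_mono) (auto simp: mult_ac intro!: mult_pos_pos)
  then have "1 / (90 * (M * M * lr * L)) * (?T * V / 2) * (1 / (8 * M)) \<le> w * (?T * V / 2) * (1 / (8 * M))"
    using ratio_bound_ge_one[of n "Suc k"] V(2) pos by (intro mult_right_mono) auto
  moreover have "1 / (90 * (M * M * lr * L)) * (?T * V / 2) * (1 / (8 * M))
      = 4 ^ m / (M * M) * (V / (1440 * (M * lr)))"
    unfolding ratio_bound_def L_def[symmetric] using pos by (simp add: field_simps)
  moreover have "1 * (V / (15360 * (M * lr))) \<le> 4 ^ m / (M * M) * (V / (1440 * (M * lr)))"
    using M4 pos V(2) by (intro mult_mono divide_left_mono) auto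
  ultimately show ?thesis
    using ge by (simp add: M_def lr_def)
qed

text \<open>Items of \<open>Opt\<close> worth less than V / (4 r) lose at most V / 4 in total and
  are dropped. Each remaining item is charged to a threshold within a factor 2 of its value, and at
  every threshold greedy selects at least as many items as are charged to it.\<close>

lemma last_window_suffices:
  assumes k: "reds_bounded m"
  shows "target \<le> expected_payoff"
proof -
  let ?J = "num_scales n r m" and ?T = "ratio_bound n m"
  define w where "w = 1 / (3 * real (Suc (2 * ?J)))"
  define I where "I = {e \<in> Opt. V / (4 * real r) \<le> val e}"
  define B where "B e = window_event m G {h, g, e} (window_of_green m)" for e
  have fin: "finite Opt"
    using Opt(1) by (rule indep_finite)
  then have fin_I: "finite I"
    by (simp add: I_def)
  have r: "0 < real r"
    using r_pos by simp
  have T: "V \<le> ?T * V"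
    using ratio_bound_ge_one[of n m] V(2) mult_right_mono[of 1 ?T V] by simp
  have I_bounds: "V / (4 * real r) \<le> val e" "val e \<le> ?T * V" if "e \<in> I" for e
    using that T val_le_V[of e] Opt Opt_nonloop by (force simp: I_def)+
  have h_I: "h \<in> I"
  proof -
    have "V \<le> 4 * (real r * val h)"
      using h(2) V(2) by linarith
    then show ?thesis
      using h(1) r by (simp add: I_def field_simps)
  qed
  have "w * (\<Sum>e\<in>I. val e / 4 * measure (green_times G) (B e)) \<le> expected_payoff"
  proof (rule expected_payoff_ge[where k = "Suc m" and J = "2 * ?J"])
    show "w \<le> pmf (seed_pmf n r) (prod_encode (Suc m, j))" if "j \<le> 2 * ?J" for j
      unfolding w_def using that by (rule pmf_seed_last)
    show "B e \<in> sets (green_times G)" if "e \<in> I" for e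
      unfolding B_def using that g_mem h_mem Opt by (intro window_event_sets) (auto simp: I_def)
    fix u assume u: "u \<in> space (green_times G)"
    let ?t = "arrival_time G s u"
    let ?\<theta> = "\<lambda>j. threshold m j ?t"
    let ?pay = "\<Sum>j\<le>2 * ?J. payoff (Suc m) j ?t"
    have pay_nonneg: "0 \<le> ?pay"
      by (simp add: sum_nonneg payoff_nonneg)
    show "(\<Sum>e\<in>I. val e / 4 * indicator (B e) u) \<le> ?pay"
    proof (cases "window m (u h) = m \<and> window m (u g) = Suc m")
      case False
      then have "u \<notin> B e" for e
        using h_mem by (auto simp: B_def window_event_def window_of_green_def)
      then show ?thesis
        using pay_nonneg by simp
    next
      case True
      then have u_win: "window m (u h) = m" "window m (u g) = Suc m"
        by auto
      have scale_ex: "\<exists>j\<le>2 * ?J. ?\<theta> j \<le> val e \<and> val e < 2 * ?\<theta> j" if "e \<in> I" for e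
        using threshold_exists[OF order_refl k u_win I_bounds[OF that]] by metis
      define Y where "Y = {e \<in> I. e \<noteq> h \<and> window m (u e) = Suc m}"
      have Y: "finite Y" "Y \<subseteq> Opt" "Y \<subseteq> G"
        using fin Opt by (auto simp: Y_def I_def)
      \<comment> \<open>Here h lies in window m, where this stage selects nothing. The item g is at
        least as valuable and takes its place in the last window.\<close>
      have "val h / 2 \<le> ?pay"
      proof -
        obtain j where j: "j \<le> 2 * ?J" "?\<theta> j \<le> val h" "val h < 2 * ?\<theta> j"
          using scale_ex[OF h_I] by blast
        have "?\<theta> j * real (card {g}) \<le> payoff (Suc m) j ?t"
          using g_mem u_win j val_le_g[OF h_mem(1,3)]
          by (intro payoff_ge_threshold) (auto simp: arrival_time_def)
        also have "\<dots> \<le> ?pay"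
          using j by (intro member_le_sum payoff_nonneg) auto
        finally show ?thesis
          using j by simp
      qed
      moreover have "(\<Sum>e\<in>Y. val e / 2) \<le> ?pay"
      proof -
        have "(\<Sum>e\<in>Y. val e / 2) \<le> (\<Sum>e\<in>Y. \<Sum>j\<le>2 * ?J. if ?\<theta> j \<le> val e then ?\<theta> j else 0)"
        proof (rule sum_mono)
          fix e assume "e \<in> Y"
          then obtain j where j: "j \<le> 2 * ?J" "?\<theta> j \<le> val e" "val e < 2 * ?\<theta> j"
            using scale_ex[of e] by (auto simp: Y_def)
          have "val e / 2 \<le> (if ?\<theta> j \<le> val e then ?\<theta> j else 0)"
            using j by simp
          also have "\<dots> \<le> (\<Sum>j\<le>2 * ?J. if ?\<theta> j \<le> val e then ?\<theta> j else 0)"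
            using j threshold_nonneg by (intro member_le_sum) auto
          finally show "val e / 2 \<le> (\<Sum>j\<le>2 * ?J. if ?\<theta> j \<le> val e then ?\<theta> j else 0)" .
        qed
        \<comment> \<open>Exchanging the sums turns charges per item into counts per threshold. The
          items counted form a subset of \<open>Opt\<close>, hence an independent set.\<close>
        also have "\<dots> = (\<Sum>j\<le>2 * ?J. \<Sum>e\<in>Y. if ?\<theta> j \<le> val e then ?\<theta> j else 0)"
          by (rule sum.swap)
        also have "\<dots> = (\<Sum>j\<le>2 * ?J. ?\<theta> j * real (card {e \<in> Y. ?\<theta> j \<le> val e}))"
          using Y(1) by (intro sum.cong refl) (simp add: sum.If_cases Int_def mult.commute)
        also have "\<dots> \<le> ?pay"
        proof (rule sum_mono, rule payoff_ge_threshold)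
          show "indep {e \<in> Y. ?\<theta> j \<le> val e}" for j
            using Y by (intro indep_hered[OF Opt(1)]) auto
        qed (use Y in \<open>auto simp: Y_def arrival_time_def\<close>)
        finally show ?thesis .
      qed
      moreover have "(\<Sum>e\<in>I. val e / 4 * indicator (B e) u) \<le> (\<Sum>e\<in>insert h Y. val e / 4)"
      proof -
        have "(\<Sum>e\<in>I. val e / 4 * indicator (B e) u) = (\<Sum>e\<in>{e \<in> I. u \<in> B e}. val e / 4)"
          unfolding sum.inter_filter[OF fin_I] by (intro sum.cong) auto
        also have "\<dots> \<le> (\<Sum>e\<in>insert h Y. val e / 4)"
        proof (rule sum_mono2)
          show "{e \<in> I. u \<in> B e} \<subseteq> insert h Y"
          proof
            fix e assume e: "e \<in> {e \<in> I. u \<in> B e}"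
            then have "window m (u e) = window_of_green m e"
              by (simp add: B_def window_event_def)
            then show "e \<in> insert h Y"
              using e by (simp add: Y_def window_of_green_def split: if_splits)
          qed
          show "0 \<le> val e / 4" if "e \<in> insert h Y - {e \<in> I. u \<in> B e}" for e
            using that Y(3) h_mem(1) G_sub val_nonneg by auto
        qed (use Y in auto)
        finally show ?thesis .
      qed
      \<comment> \<open>The gains from h and from Y may be the same payoff, so each is used with
        weight one half. This explains the quarter of \<open>val e\<close> in the claim.\<close>
      moreover have "(\<Sum>e\<in>insert h Y. val e / 4) = val h / 4 + (\<Sum>e\<in>Y. val e / 2) / 2"
        using Y(1) by (simp add: Y_def sum_divide_distrib)
      ultimately show ?thesis
        by linarith
    qed
  qed (use fin in \<open>auto simp: w_def I_def\<close>)
  moreover have "3 * V / 1024 \<le> (\<Sum>e\<in>I. val e / 4 * measure (green_times G) (B e))"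
  proof -
    have B_prob: "1 / 64 \<le> measure (green_times G) (B e)" if "e \<in> I" for e
    proof -
      have "(\<Prod>e\<in>{h, g, e}. 1 / 4) \<le> measure (green_times G) (B e)"
        unfolding B_def
        using that g_mem h_mem Opt window_prob_late[of m m] window_prob_late[of "Suc m" m]
        by (intro window_event_prob) (auto simp: I_def window_of_green_def simp del: measure_uniform_measure)
      \<comment> \<open>For e = h there are only two distinct items and the product is
        larger.\<close>
      moreover have "(1 / 4 :: real) ^ 3 \<le> (1 / 4) ^ card {h, g, e}"
        by (intro power_decreasing) (auto simp: card_insert_if)
      ultimately show ?thesis
        by (simp add: power3_eq_cube)
    qed
    have nonneg: "0 \<le> val e" if "e \<in> Opt" for e
      using that Opt(2) G_sub val_nonneg by blast
    have "(\<Sum>e\<in>Opt - I. val e) \<le> real (card (Opt - I)) * (V / (4 * real r))"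
      by (rule sum_bounded_above) (auto simp: I_def)
    also have "\<dots> \<le> real r * (V / (4 * real r))"
      using card_indep_le[of "Opt - I"] indep_hered[OF Opt(1), of "Opt - I"] V(2)
      by (intro mult_right_mono) auto
    also have "\<dots> = V / 4"
      using r by simp
    finally have "3 * V / 4 \<le> (\<Sum>e\<in>I. val e)"
      using Opt(3) sum.subset_diff[of I Opt val] fin by (auto simp: I_def)
    then have "3 * V / 1024 \<le> (\<Sum>e\<in>I. val e / 4 * (1 / 64))"
      by (simp add: sum_divide_distrib[symmetric])
    also have "\<dots> \<le> (\<Sum>e\<in>I. val e / 4 * measure (green_times G) (B e))"
      using B_prob nonneg by (intro sum_mono mult_left_mono) (auto simp: I_def)
    finally show ?thesis .
  qed
  ultimately have ge: "w * (3 * V / 1024) \<le> expected_payoff"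
    using mult_left_mono[of "3 * V / 1024" "\<Sum>e\<in>I. val e / 4 * measure (green_times G) (B e)" w]
    by (simp add: w_def)
  define D where "D = real m * max 1 (log 2 (real r))"
  have "0 < D"
    using m_pos by (simp add: D_def)
  \<comment> \<open>The level of stage m is 1, so its logarithm vanishes and L = 1 is
    admissible.\<close>
  have "real (Suc (2 * ?J)) \<le> 15 * D"
    using num_scales_le[OF r_pos m_pos, of m 1] by (simp add: level_log_star D_def)
  then have "1 / (3 * (15 * D)) \<le> w"
    unfolding w_def using \<open>0 < D\<close> by (intro divide_left_mono) auto
  then have "1 / (3 * (15 * D)) * (3 * V / 1024) \<le> w * (3 * V / 1024)"
    using V(2) by (intro mult_right_mono) auto
  moreover have "1 / (3 * (15 * D)) * (3 * V / 1024) = V / (15360 * D)"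
    by simp
  ultimately show ?thesis
    using ge by (simp add: D_def)
qed

text \<open>If the target were missed, no window could violate its bound: a violation in window 0
  makes a random position pay off, and a later first violation makes a refinement pay off. Then the
  last stage reaches the target after all.\<close>

lemma expected_payoff_target: "target \<le> expected_payoff"
proof (rule ccontr)
  assume less: "\<not> target \<le> expected_payoff"
  have "1 \<le> real m * max 1 (log 2 (real r))"
    using m_pos mult_mono[of 1 "real m" 1 "max 1 (log 2 (real r))"] by simp
  then have "target \<le> V / 6"
    using V(2) by (intro divide_left_mono) auto
  have "reds_bounded k" if "k \<le> m" for k
    using that
  proof (induction k)
    case 0
    show ?case
    proof (rule ccontr)
      assume "\<not> reds_bounded 0"
      then obtain e where e: "e < n" "indep {e}" "ratio_bound n 0 * V < val e"
        by (auto simp: reds_bounded_def not_le)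
      have "real n \<le> ratio_bound n 0"
        using n_ge mult_right_mono[of 1 "4 ^ m" "real n"]
        by (simp add: ratio_bound_def level_def)
      then have "real n * V \<le> ratio_bound n 0 * V"
        using V(2) by (intro mult_right_mono) auto
      then show False
        using huge_item_suffices[OF e(1,2)] e(3) less \<open>target \<le> V / 6\<close> by linarith
    qed
  next
    case (Suc k)
    then show ?case
      using refinement_suffices[of k] less by auto
  qed
  then show False
    using last_window_suffices less by blast
qed

end

section \<open>The competitive ratio for arbitrary benchmarks\<close>

context byzantine_matroid
begin

lemma finite_independent_subsets: "finite {I. indep I \<and> I \<subseteq> S}"
  by (rule finite_subset[OF _ finite_indep]) auto

lemma matroid_opt_nonneg: "0 \<le> matroid_opt indep val S"
proof -
  have "sum val {} \<le> matroid_opt indep val S"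
    unfolding matroid_opt_def
    by (intro Max_ge finite_imageI finite_independent_subsets imageI) (simp add: indep_empty)
  then show ?thesis
    by simp
qed

lemma expected_payoff_nonneg: "0 \<le> expected_payoff"
  using total_payoff_nonneg by (intro integral_nonneg_AE) auto

lemma expected_payoff_competitive:
  assumes g: "most_valuable val (non_loops indep G) g"
  shows "1 / 15360 / (real m * max 1 (log 2 (real r))) * matroid_opt indep val (G - {g}) \<le> expected_payoff"
\<comment> \<open>For m = 0 the quotient is 0, as division by zero yields 0. This covers n \<le>
  1.\<close>
proof (cases "m = 0 \<or> matroid_opt indep val (G - {g}) = 0")
  case True
  then show ?thesis
    using expected_payoff_nonneg by auto
next
  case False
  define V where "V = matroid_opt indep val (G - {g})"
  have n: "2 \<le> n"
    using False log_star_le_one[of n] by linarith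
  have V: "0 < V"
    using False matroid_opt_nonneg[of "G - {g}"] by (simp add: V_def)
  have "V \<in> sum val ` {I. indep I \<and> I \<subseteq> G - {g}}"
    unfolding V_def matroid_opt_def
    by (rule Max_in) (use finite_independent_subsets indep_empty in auto)
  then obtain Opt where Opt: "indep Opt" "Opt \<subseteq> G - {g}" "sum val Opt = V"
    by auto
  have fin: "finite (val ` Opt)" "val ` Opt \<noteq> {}"
    using indep_finite[OF Opt(1)] Opt(3) V by auto
  \<comment> \<open>The most valuable item of \<open>Opt\<close> carries at least a 1 / r share,
    because \<open>Opt\<close> has at most r elements.\<close>
  obtain h where h: "h \<in> Opt" "val h = Max (val ` Opt)"
    using Max_in[OF fin] by (metis imageE)
  have "V \<le> real (card Opt) * val h"
    unfolding Opt(3)[symmetric] h(2) using fin by (intro sum_bounded_above Max_ge) auto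
  also have "\<dots> \<le> real r * val h"
    using card_indep_le[OF Opt(1)] h(1) Opt(2) G_sub val_nonneg[of h] by (intro mult_right_mono) auto
  finally have V_le: "V \<le> real r * val h" .
  interpret byzantine_benchmark n r indep G val s g h V Opt
    by unfold_locales (fact n g V_def V Opt h(1) V_le)+
  show ?thesis
    using expected_payoff_target by (simp add: V_def mult_ac)
qed

end

subsection \<open>The single-item problem as a matroid of rank one\<close>

text \<open>The uniform matroid of rank \<open>min 1 n\<close>, which has no loops.\<close>

definition rank_one_indep :: "nat \<Rightarrow> nat set \<Rightarrow> bool" where
  "rank_one_indep n X \<longleftrightarrow> X \<subseteq> {..<n} \<and> card X \<le> 1"

lemma rank_one_indep_cases:
  assumes "rank_one_indep n X"
  obtains "X = {}" | e where "X = {e}" "e < n"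
proof -
  have "finite X" "X \<subseteq> {..<n}"
    using assms finite_subset by (auto simp: rank_one_indep_def)
  then show ?thesis
    using assms that by (cases "card X") (auto simp: rank_one_indep_def card_1_singleton_iff)
qed

lemma rank_one_indep_empty: "rank_one_indep n {}"
  and rank_one_indep_singleton: "e < n \<Longrightarrow> rank_one_indep n {e}"
  by (auto simp: rank_one_indep_def)

lemma matroid_rank_one: "matroid {..<n} (rank_one_indep n)"
  unfolding matroid_def
proof (intro conjI allI impI)
  fix X Y
  show "rank_one_indep n Y" if "rank_one_indep n X" "Y \<subseteq> X"
    using that(1)
  proof (cases rule: rank_one_indep_cases)
    case (2 e)
    then show ?thesis
      using that(2) rank_one_indep_empty rank_one_indep_singleton by (auto simp: subset_singleton_iff)
  qed (use that(2) rank_one_indep_empty in auto)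
  show "\<exists>y\<in>Y - X. rank_one_indep n (insert y X)"
    if "rank_one_indep n X" "rank_one_indep n Y" "card X < card Y"
    using that(2)
  proof (cases rule: rank_one_indep_cases)
    case (2 e)
    moreover have "X = {}"
      using that(1,3) 2 by (cases rule: rank_one_indep_cases) auto
    ultimately show ?thesis
      using rank_one_indep_singleton by auto
  qed (use that(3) in simp)
qed (auto simp: rank_one_indep_def)

lemma matroid_rank_rank_one: "matroid_rank (rank_one_indep n) = min 1 n"
  unfolding matroid_rank_def
proof (rule Max_eqI)
  show "finite (card ` {X. rank_one_indep n X})"
    by (rule finite_subset[of _ "{..1}"]) (auto simp: rank_one_indep_def)
  show "y \<le> min 1 n" if y: "y \<in> card ` {X. rank_one_indep n X}" for y
  proof -
    obtain X where X: "rank_one_indep n X" "y = card X"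
      using y by blast
    show ?thesis
      using X(1) by (cases rule: rank_one_indep_cases) (simp_all add: X(2))
  qed
  have "card (if n = 0 then {} else {0::nat}) = min 1 n"
    by simp
  moreover have "rank_one_indep n (if n = 0 then {} else {0})"
    using rank_one_indep_empty rank_one_indep_singleton by simp
  ultimately show "min 1 n \<in> card ` {X. rank_one_indep n X}"
    by (intro image_eqI[OF sym CollectI])
qed

text \<open>What this matroid reveals depends only on the number of arrivals, so a single-item
  algorithm can supply it to the matroid algorithm by itself.\<close>

lemma revealed_rank_one:
  assumes "distinct es" "set es \<subseteq> {..<n}"
  shows "revealed_indep (rank_one_indep n) es = {K. K \<subseteq> {..<length es} \<and> card K \<le> 1}"
proof -
  have "rank_one_indep n ((!) es ` K) \<longleftrightarrow> card K \<le> 1" if K: "K \<subseteq> {..<length es}" for K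
  proof -
    have "inj_on ((!) es) K"
      using assms(1) K by (intro inj_on_nth) auto
    moreover have "(!) es ` K \<subseteq> {..<n}"
    proof (rule image_subsetI)
      fix i assume "i \<in> K"
      then have "es ! i \<in> set es"
        using K by (intro nth_mem) auto
      then show "es ! i \<in> {..<n}"
        using assms(2) by (rule rev_subsetD)
    qed
    ultimately show ?thesis
      by (simp add: rank_one_indep_def card_image)
  qed
  then show ?thesis
    unfolding revealed_indep_def by blast
qed

definition byzantine_single_algorithm :: "nat \<Rightarrow> single_algorithm" where
  "byzantine_single_algorithm n \<omega> h =
     byzantine_algorithm n (min 1 n) \<omega> h {K. K \<subseteq> {..<length h} \<and> card K \<le> 1}"

lemma single_selected_eq:
  "single_selected (byzantine_single_algorithm n) n val t \<omega> =
    matroid_selected (byzantine_algorithm n (min 1 n)) n (rank_one_indep n) val t \<omega>"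
  unfolding single_selected_def matroid_selected_def
proof (rule online_selection_cong)
  fix k
  let ?es = "take (Suc k) (arrival_order n t)"
  have "set ?es \<subseteq> {..<n}"
    using set_take_subset[of "Suc k" "arrival_order n t"] by (simp add: arrival_order_props)
  then have "revealed_indep (rank_one_indep n) ?es = {K. K \<subseteq> {..<length ?es} \<and> card K \<le> 1}"
    using arrival_order_props(3)[of n t] by (intro revealed_rank_one distinct_take)
  then show "byzantine_single_algorithm n \<omega> (history val t ?es) =
      byzantine_algorithm n (min 1 n) \<omega> (history val t ?es) (revealed_indep (rank_one_indep n) ?es)"
    by (simp add: byzantine_single_algorithm_def history_def)
qed

lemma single_payoff_eq:
  "single_payoff (byzantine_single_algorithm n) n G val s =
    matroid_payoff (byzantine_algorithm n (min 1 n)) n (rank_one_indep n) G val s"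
  by (simp add: single_payoff_def matroid_payoff_def single_selected_eq)

lemma matroid_opt_rank_one:
  assumes "S \<subseteq> {..<n}"
  shows "matroid_opt (rank_one_indep n) val S = single_opt val S"
proof -
  have "sum val ` {I. rank_one_indep n I \<and> I \<subseteq> S} = insert 0 (val ` S)" (is "?A = ?B")
  proof (intro equalityI subsetI)
    fix x assume "x \<in> ?A"
    then obtain I where "rank_one_indep n I" "I \<subseteq> S" "x = sum val I"
      by blast
    then show "x \<in> ?B"
      by (cases rule: rank_one_indep_cases) auto
  next
    fix x assume "x \<in> ?B"
    then consider "x = sum val {}" | e where "e \<in> S" "x = sum val {e}"
      by auto
    then show "x \<in> ?A"
      using assms rank_one_indep_empty rank_one_indep_singleton by cases blast+
  qed
  then show ?thesis
    by (simp add: matroid_opt_def single_opt_def)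
qed

theorem theorem1p5:
  shows
   "(\<exists>c>0::real. \<exists>(R :: nat \<Rightarrow> real measure) (A :: nat \<Rightarrow> single_algorithm). \<forall>n.
       seed_distribution (R n) \<and>
       (\<forall>G val s. byzantine_instance n G val s \<longrightarrow>
          (\<forall>\<omega>. \<forall>u\<in>G \<rightarrow> {0..1}. card (single_selected (A n) n val (arrival_time G s u) \<omega>) \<le> 1) \<and>
          integrable (outcomes (R n) G) (single_payoff (A n) n G val s) \<and>
          (\<forall>g. most_valuable val G g \<longrightarrow>
             c / real (log_star (real n)) * single_opt val (G - {g})
               \<le> integral\<^sup>L (outcomes (R n) G) (single_payoff (A n) n G val s))))
    \<and>
    (\<exists>c>0::real. \<exists>(R :: nat \<Rightarrow> nat \<Rightarrow> real measure) (A :: nat \<Rightarrow> nat \<Rightarrow> matroid_algorithm). \<forall>n r.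
       seed_distribution (R n r) \<and>
       (\<forall>indep G val s.
          matroid {..<n} indep \<and> matroid_rank indep = r \<and> byzantine_instance n G val s \<longrightarrow>
          (\<forall>\<omega>. \<forall>u\<in>G \<rightarrow> {0..1}.
             indep (matroid_selected (A n r) n indep val (arrival_time G s u) \<omega>)) \<and>
          integrable (outcomes (R n r) G) (matroid_payoff (A n r) n indep G val s) \<and>
          (\<forall>g. most_valuable val (non_loops indep G) g \<longrightarrow>
             c / ((real (log_star (real n)))\<^sup>2 * max 1 (log 2 (real r))) * matroid_opt indep val (G - {g})
               \<le> integral\<^sup>L (outcomes (R n r) G) (matroid_payoff (A n r) n indep G val s))))"
proof (intro conjI)
  show "\<exists>c>0::real. \<exists>(R :: nat \<Rightarrow> real measure) (A :: nat \<Rightarrow> single_algorithm). \<forall>n.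
       seed_distribution (R n) \<and>
       (\<forall>G val s. byzantine_instance n G val s \<longrightarrow>
          (\<forall>\<omega>. \<forall>u\<in>G \<rightarrow> {0..1}. card (single_selected (A n) n val (arrival_time G s u) \<omega>) \<le> 1) \<and>
          integrable (outcomes (R n) G) (single_payoff (A n) n G val s) \<and>
          (\<forall>g. most_valuable val G g \<longrightarrow>
             c / real (log_star (real n)) * single_opt val (G - {g})
               \<le> integral\<^sup>L (outcomes (R n) G) (single_payoff (A n) n G val s)))"
  proof (intro exI[of _ "1 / 15360 :: real"] exI[of _ "\<lambda>n. seed_measure n (min 1 n)"]
      exI[of _ byzantine_single_algorithm] conjI allI impI ballI)
    fix n G val s assume inst: "byzantine_instance n G val s"
    interpret byzantine_matroid n "min 1 n" "rank_one_indep n" G val s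
      by unfold_locales (fact matroid_rank_one matroid_rank_rank_one inst)+
    show "card (single_selected (byzantine_single_algorithm n) n val (arrival_time G s u) \<omega>) \<le> 1" for u \<omega>
      unfolding single_selected_eq by (rule conjunct2[OF iffD1[OF rank_one_indep_def indep_selected]])
    show "integrable (outcomes (seed_measure n (min 1 n)) G)
        (single_payoff (byzantine_single_algorithm n) n G val s)"
      unfolding single_payoff_eq by (rule total_payoff_integrable[OF seed_distribution_seed_measure])
    fix g assume "most_valuable val G g"
    moreover have "non_loops (rank_one_indep n) G = G"
      using G_sub rank_one_indep_singleton by (auto simp: non_loops_def)
    ultimately have "1 / 15360 / (real m * max 1 (log 2 (real (min 1 n)))) *
        matroid_opt (rank_one_indep n) val (G - {g}) \<le> expected_payoff"
      by (intro expected_payoff_competitive) simp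
    \<comment> \<open>For n = 0 the rank is 0, but then m = 0 and the claimed bound is 0.\<close>
    moreover have "max 1 (log 2 (real (min 1 n))) = 1 \<or> m = 0"
      using log_star_le_one[of n] by (cases "n = 0") auto
    moreover have "matroid_opt (rank_one_indep n) val (G - {g}) = single_opt val (G - {g})"
      using G_sub by (intro matroid_opt_rank_one) auto
    ultimately show "1 / 15360 / real (log_star (real n)) * single_opt val (G - {g})
        \<le> integral\<^sup>L (outcomes (seed_measure n (min 1 n)) G)
            (single_payoff (byzantine_single_algorithm n) n G val s)"
      unfolding single_payoff_eq by auto
  qed (simp_all add: seed_distribution_seed_measure)
next
  show "\<exists>c>0::real. \<exists>(R :: nat \<Rightarrow> nat \<Rightarrow> real measure) (A :: nat \<Rightarrow> nat \<Rightarrow> matroid_algorithm). \<forall>n r.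
       seed_distribution (R n r) \<and>
       (\<forall>indep G val s.
          matroid {..<n} indep \<and> matroid_rank indep = r \<and> byzantine_instance n G val s \<longrightarrow>
          (\<forall>\<omega>. \<forall>u\<in>G \<rightarrow> {0..1}.
             indep (matroid_selected (A n r) n indep val (arrival_time G s u) \<omega>)) \<and>
          integrable (outcomes (R n r) G) (matroid_payoff (A n r) n indep G val s) \<and>
          (\<forall>g. most_valuable val (non_loops indep G) g \<longrightarrow>
             c / ((real (log_star (real n)))\<^sup>2 * max 1 (log 2 (real r))) * matroid_opt indep val (G - {g})
               \<le> integral\<^sup>L (outcomes (R n r) G) (matroid_payoff (A n r) n indep G val s)))"
  proof (intro exI[of _ "1 / 15360 :: real"] exI[of _ seed_measure] exI[of _ byzantine_algorithm]
      conjI allI impI ballI; (elim conjE)?)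
    fix n r indep G val s
    assume "matroid {..<n} indep" "matroid_rank indep = r" "byzantine_instance n G val s"
    then interpret byzantine_matroid n r indep G val s
      by unfold_locales
    show "indep (selected (arrival_time G s u) \<omega>)" for u \<omega>
      by (rule indep_selected)
    show "integrable (outcomes (seed_measure n r) G) total_payoff"
      by (rule total_payoff_integrable[OF seed_distribution_seed_measure])
    fix g assume g: "most_valuable val (non_loops indep G) g"
    let ?l = "max 1 (log 2 (real r))" and ?opt = "matroid_opt indep val (G - {g})"
    \<comment> \<open>The ratio obtained is linear in m, hence stronger than the claimed quadratic
      one. For m = 0 both quotients are 0.\<close>
    have "1 / 15360 / ((real m)\<^sup>2 * ?l) \<le> 1 / 15360 / (real m * ?l)"
    proof (cases "m = 0")
      case False
      then have "real m * 1 \<le> real m * real m"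
        by (intro mult_left_mono) auto
      then show ?thesis
        using False by (intro divide_left_mono mult_right_mono) (auto simp: power2_eq_square)
    qed simp
    then have "1 / 15360 / ((real m)\<^sup>2 * ?l) * ?opt \<le> 1 / 15360 / (real m * ?l) * ?opt"
      by (intro mult_right_mono matroid_opt_nonneg)
    also have "\<dots> \<le> expected_payoff"
      by (rule expected_payoff_competitive[OF g])
    finally show "1 / 15360 / ((real m)\<^sup>2 * ?l) * ?opt \<le> expected_payoff" .
  qed (simp_all add: seed_distribution_seed_measure)
qed

end
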